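(* There exists a polynomial-time algorithm which, given cographs $G$ and $H$, computes $\alpha(G\times H)$.
   Context: A cograph is a graph with no induced path on four vertices. For graphs $G$ and $H$, the categorical (tensor) product $G \times H$ has vertex set $V(G)\times V(H)$, and $(g_1,h_1)$ is adjacent to $(g_2,h_2)$ iff $\{g_1,g_2\}\in E(G)$ and $\{h_1,h_2\}\in E(H)$. $\alpha(\cdot)$ is the independence number. *)

theory Defs
  imports "HOL-Library.Discrete_Functions" "HOL-Computational_Algebra.Polynomial"
begin

section \<open>Graphs\<close>

type_synonym 'a graph = "'a set \<times> 'a set set"

abbreviation verts :: "'a graph \<Rightarrow> 'a set" where
  "verts G \<equiv> fst G"

abbreviation edges :: "'a graph \<Rightarrow> 'a set set" where
  "edges G \<equiv> snd G"

definition finite_simple_graph :: "'a graph \<Rightarrow> bool" where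
  "finite_simple_graph G \<longleftrightarrow>
     finite (verts G) \<and> (\<forall>e \<in> edges G. e \<subseteq> verts G \<and> card e = 2)"

definition induced_P4 :: "'a graph \<Rightarrow> 'a \<Rightarrow> 'a \<Rightarrow> 'a \<Rightarrow> 'a \<Rightarrow> bool" where
  "induced_P4 G a b c d \<longleftrightarrow>
     {a, b, c, d} \<subseteq> verts G \<and> distinct [a, b, c, d] \<and>
     {a, b} \<in> edges G \<and> {b, c} \<in> edges G \<and> {c, d} \<in> edges G \<and>
     {a, c} \<notin> edges G \<and> {a, d} \<notin> edges G \<and> {b, d} \<notin> edges G"

definition cograph :: "'a graph \<Rightarrow> bool" where
  "cograph G \<longleftrightarrow> finite_simple_graph G \<and> \<not> (\<exists>a b c d. induced_P4 G a b c d)"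

definition tensor_product :: "'a graph \<Rightarrow> 'b graph \<Rightarrow> ('a \<times> 'b) graph" where
  "tensor_product G H =
     (verts G \<times> verts H,
      {{(g1, h1), (g2, h2)} | g1 g2 h1 h2. {g1, g2} \<in> edges G \<and> {h1, h2} \<in> edges H})"

definition independent_set :: "'a graph \<Rightarrow> 'a set \<Rightarrow> bool" where
  "independent_set G S \<longleftrightarrow> S \<subseteq> verts G \<and> (\<forall>x \<in> S. \<forall>y \<in> S. {x, y} \<notin> edges G)"

definition independence_number :: "'a graph \<Rightarrow> nat" where
  "independence_number G = Max (card ` {S. independent_set G S})"

section \<open>Polynomial time on random access machines\<close>

text \<open>
  A random access machine in the style of Cook and Reckhow (see also Papadimitriou, Computational
  Complexity, Section 2.6): a fixed finite program, registers holding natural numbers, and a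
  separate read-only input. Every instruction costs one unit. Since the only arithmetic operations
  are addition and (truncated) subtraction, one step can increase the length of the largest number
  stored by at most one bit beyond what is present in the program and the input; hence, measured
  against the bit size of the input, unit-cost time and Turing machine time are polynomially
  related. Multiplication as a unit-cost instruction would break this and is deliberately absent.
\<close>

datatype instr =
    Const nat nat
  | Add nat nat nat
  | Sub nat nat nat
  | Load nat nat
  | Store nat nat
  | Read nat nat
  | Jump nat
  | JumpZero nat nat

type_synonym ram_state = "nat \<times> (nat \<Rightarrow> nat)"

fun exec_instr :: "nat list \<Rightarrow> instr \<Rightarrow> ram_state \<Rightarrow> ram_state" where
  "exec_instr x (Const i k) (pc, M) = (Suc pc, M(i := k))"
| "exec_instr x (Add i j k) (pc, M) = (Suc pc, M(i := M j + M k))"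
| "exec_instr x (Sub i j k) (pc, M) = (Suc pc, M(i := M j - M k))"
| "exec_instr x (Load i j) (pc, M) = (Suc pc, M(i := M (M j)))"
| "exec_instr x (Store i j) (pc, M) = (Suc pc, M(M i := M j))"
| "exec_instr x (Read i j) (pc, M) = (Suc pc, M(i := (if M j < length x then x ! M j else 0)))"
| "exec_instr x (Jump l) (pc, M) = (l, M)"
| "exec_instr x (JumpZero i l) (pc, M) = (if M i = 0 then l else Suc pc, M)"

text \<open>
  The machine halts when the program counter leaves the program. A halted state is a fixed point
  of \<open>ram_step\<close>, so \<open>halts_within P x t y\<close> says that at most \<open>t\<close> instructions are executed.
\<close>

definition ram_step :: "instr list \<Rightarrow> nat list \<Rightarrow> ram_state \<Rightarrow> ram_state" where
  "ram_step P x s = (if fst s < length P then exec_instr x (P ! fst s) s else s)"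

definition halts_within :: "instr list \<Rightarrow> nat list \<Rightarrow> nat \<Rightarrow> nat \<Rightarrow> bool" where
  "halts_within P x t y \<longleftrightarrow>
     (case (ram_step P x ^^ t) (0, \<lambda>_. 0) of (pc, M) \<Rightarrow> length P \<le> pc \<and> M 0 = y)"

definition bit_size :: "nat list \<Rightarrow> nat" where
  "bit_size x = (\<Sum>k\<leftarrow>x. floor_log k + 1)"

text \<open>
  Nothing is required of the program on inputs that do not encode an instance in \<open>D\<close>.
\<close>

definition poly_time_computable_on ::
    "'i set \<Rightarrow> ('i \<Rightarrow> nat list) \<Rightarrow> ('i \<Rightarrow> nat) \<Rightarrow> bool" where
  "poly_time_computable_on D enc f \<longleftrightarrow>
     (\<exists>(P :: instr list) (p :: nat poly). \<forall>i \<in> D.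
        halts_within P (enc i) (poly p (bit_size (enc i))) (f i))"

section \<open>Graphs as inputs\<close>

text \<open>
  A graph on \<open>n\<close> vertices is presented with vertex set \<open>{..<n}\<close>, as \<open>n\<close> followed by its adjacency
  matrix in row-major order.
\<close>

definition numbered :: "nat graph \<Rightarrow> bool" where
  "numbered G \<longleftrightarrow> verts G = {..<card (verts G)}"

definition encode_graph :: "nat graph \<Rightarrow> nat list" where
  "encode_graph G =
     (let n = card (verts G)
      in n # [of_bool ({i, j} \<in> edges G). i \<leftarrow> [0..<n], j \<leftarrow> [0..<n]])"

definition encode_graph_pair :: "nat graph \<times> nat graph \<Rightarrow> nat list" where
  "encode_graph_pair = (\<lambda>(G, H). encode_graph G @ encode_graph H)"

end

theory Submission
  imports Defs
begin

text \<open>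
  If \<open>G\<close> is a disjoint union, then \<open>\<alpha>(G \<times> H)\<close> is the sum over its two parts. If \<open>G = G\<^sub>1 \<otimes> G\<^sub>2\<close> and
  \<open>H = H\<^sub>1 \<otimes> H\<^sub>2\<close> are both joins, opposite quadrants \<open>G\<^sub>i \<times> H\<^sub>j\<close> are completely adjacent, so an
  independent set lies in one of \<open>G\<^sub>1 \<times> H\<close>, \<open>G\<^sub>2 \<times> H\<close>, \<open>G \<times> H\<^sub>1\<close>, \<open>G \<times> H\<^sub>2\<close>. Hence \<open>\<alpha>\<close> is computed by
  dynamic programming over the pairs of nodes of the two cotrees. A binary cotree is found by
  repeatedly merging a pair of twins, which exists in every cograph with at least two vertices.

  The algorithm is written in a language whose loops all run for a fixed number \<open>N\<close> of rounds, so
  that polynomial running time of the compiled machine program holds for every program of the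
  language. It runs in two phases, since the order of \<open>H\<close> stands at position \<open>n\<^sup>2 + 1\<close> of the input and
  a loop is needed to compute that position before \<open>N\<close> can be chosen.
\<close>

section \<open>Twins in cographs\<close>

text \<open>A merged class is represented by one of its vertices, which sees every other class as
  all its members do; so every test reads the original matrix and no reduced graph is ever built.
  The recurrence only asks that each inner node be a disjoint union or a join of its two children,
  so any order of merging will do and no normal form of the cotree is involved. Node numbers grow
  along the tree, hence a row-major sweep over pairs of nodes evaluates it. The machine has no
  multiplication, so each index into a matrix or the table is a precomputed row offset plus a
  column. The bound \<open>N = 2 * n + 2 * m\<close> of the second phase is at least both node
  counts, \<open>2 * n - 1\<close> and \<open>2 * m - 1\<close>, and serves as the length of a table
  row as well. The price of one common bound is that loops overrun their range: there each must be
  idle or leave only entries that are overwritten or ignored. \<open>N\<close> is at most linear in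
  the input size because an \<open>n\<close>-vertex graph is written with \<open>n * n\<close>
  matrix entries, each counted as at least one bit.\<close>

definition P4_free_on :: "'a set \<Rightarrow> ('a \<Rightarrow> 'a \<Rightarrow> bool) \<Rightarrow> bool" where
  "P4_free_on L E \<longleftrightarrow> (\<forall>a\<in>L. \<forall>b\<in>L. \<forall>c\<in>L. \<forall>d\<in>L. distinct [a, b, c, d] \<longrightarrow>
     \<not> (E a b \<and> E b c \<and> E c d \<and> \<not> E a c \<and> \<not> E a d \<and> \<not> E b d))"

lemma P4_free_onD:
  assumes "P4_free_on L E" "a \<in> L" "b \<in> L" "c \<in> L" "d \<in> L" "distinct [a, b, c, d]"
    "E a b" "E b c" "E c d" "\<not> E a c" "\<not> E a d" "\<not> E b d"
  shows False
proof -
  have "distinct [a, b, c, d] \<longrightarrow>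
     \<not> (E a b \<and> E b c \<and> E c d \<and> \<not> E a c \<and> \<not> E a d \<and> \<not> E b d)"
    using assms(1-5) unfolding P4_free_on_def by blast
  then show False
    using assms(6-) by simp
qed

lemma P4_free_on_subset:
  assumes "P4_free_on L E" "L' \<subseteq> L"
  shows "P4_free_on L' E"
  unfolding P4_free_on_def
proof (intro ballI)
  fix a b c d
  assume "a \<in> L'" "b \<in> L'" "c \<in> L'" "d \<in> L'"
  then have "a \<in> L" "b \<in> L" "c \<in> L" "d \<in> L"
    using assms(2) by auto
  then show "distinct [a, b, c, d] \<longrightarrow>
      \<not> (E a b \<and> E b c \<and> E c d \<and> \<not> E a c \<and> \<not> E a d \<and> \<not> E b d)"
    using P4_free_onD[OF assms(1)] by blast
qed

text \<open>The path on four vertices is self-complementary: an induced path \<open>a b c d\<close>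
  of the complement is the induced path \<open>c a d b\<close> of \<open>E\<close>.\<close>

lemma P4_free_on_complement:
  assumes "P4_free_on L E" "symp E"
  shows "P4_free_on L (\<lambda>x y. x \<noteq> y \<and> \<not> E x y)"
  unfolding P4_free_on_def
proof (intro ballI impI notI, elim conjE)
  fix a b c d
  assume "a \<in> L" "b \<in> L" "c \<in> L" "d \<in> L" "distinct [a, b, c, d]"
    "\<not> E a b" "\<not> E b c" "\<not> E c d" "\<not> (a \<noteq> c \<and> \<not> E a c)" "\<not> (a \<noteq> d \<and> \<not> E a d)"
    "\<not> (b \<noteq> d \<and> \<not> E b d)"
  then show False
    using P4_free_onD[OF assms(1), of c a d b] assms(2) by (auto dest: sympD)
qed

text \<open>For symmetric \<open>E\<close> this says that the graph or its complement is
  disconnected, without any talk of paths or components.\<close>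

definition homogeneous_split :: "'a set \<Rightarrow> ('a \<Rightarrow> 'a \<Rightarrow> bool) \<Rightarrow> 'a set \<Rightarrow> 'a set \<Rightarrow> bool" where
  "homogeneous_split L E A B \<longleftrightarrow> A \<noteq> {} \<and> B \<noteq> {} \<and> A \<union> B = L \<and> A \<inter> B = {} \<and>
     ((\<forall>a\<in>A. \<forall>b\<in>B. E a b) \<or> (\<forall>a\<in>A. \<forall>b\<in>B. \<not> E a b))"

lemma homogeneous_split_complement:
  assumes "homogeneous_split L (\<lambda>x y. x \<noteq> y \<and> \<not> E x y) A B"
  shows "homogeneous_split L E A B"
proof -
  have "a \<noteq> b" if "a \<in> A" "b \<in> B" for a b
    using assms that unfolding homogeneous_split_def by auto
  then have "(\<forall>a\<in>A. \<forall>b\<in>B. a \<noteq> b \<and> \<not> E a b) = (\<forall>a\<in>A. \<forall>b\<in>B. \<not> E a b)"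
    "(\<forall>a\<in>A. \<forall>b\<in>B. \<not> (a \<noteq> b \<and> \<not> E a b)) = (\<forall>a\<in>A. \<forall>b\<in>B. E a b)"
    by auto
  then show ?thesis
    using assms unfolding homogeneous_split_def by metis
qed

text \<open>If \<open>x\<close> is adjacent to all of \<open>L\<close>, then \<open>{x}\<close>
  splits off. Otherwise it misses some vertex, say in \<open>A\<close>. Without a neighbour in
  \<open>B\<close> it is added to \<open>A\<close>; with one, the vertices of \<open>A\<close> that
  it misses are cut off from everything else. Splits with all edges across are reached through the
  complement.\<close>

lemma homogeneous_split_insert:
  assumes free: "P4_free_on (insert x L) E" and sym: "symp E" and x: "x \<notin> L"
    and AB: "A \<noteq> {}" "B \<noteq> {}" "A \<union> B = L" "A \<inter> B = {}" "\<forall>a\<in>A. \<forall>b\<in>B. \<not> E a b"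
  shows "\<exists>A B. homogeneous_split (insert x L) E A B"
proof -
  have sym': "E u v \<longleftrightarrow> E v u" for u v
    using sym by (auto dest: sympD)
  have *: "\<exists>A B. homogeneous_split (insert x L) E A B"
    if A: "A \<noteq> {}" "B \<noteq> {}" "A \<union> B = L" "A \<inter> B = {}" "\<forall>a\<in>A. \<forall>b\<in>B. \<not> E a b"
      and y: "y \<in> A" "\<not> E x y" for A B y
  proof (cases "\<exists>z\<in>B. E x z")
    case False
    then have "homogeneous_split (insert x L) E (insert x A) B"
      using A x unfolding homogeneous_split_def by auto
    then show ?thesis by blast
  next
    case True
    then obtain z where z: "z \<in> B" "E x z" by blast
    \<comment> \<open>An edge between a nonneighbour \<open>c\<close> and a neighbour
      \<open>p\<close> of \<open>x\<close> inside \<open>A\<close> would complete the induced path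
      \<open>z x p c\<close>.\<close>
    let ?C = "{a \<in> A. \<not> E x a}"
    have "\<not> E c p" if "c \<in> ?C" "p \<in> A" "E x p" for c p
    proof
      assume "E c p"
      have "distinct [z, x, p, c]"
        using that z A x by auto
      then show False
        using P4_free_onD[OF free, of z x p c] that z A x \<open>E c p\<close> sym' by auto
    qed
    then have "\<forall>c\<in>?C. \<forall>b\<in>insert x L - ?C. \<not> E c b"
      using A(3,5) sym' by blast
    moreover have "?C \<subseteq> L" "?C \<noteq> {}"
      using A(3) y by auto
    ultimately have "homogeneous_split (insert x L) E ?C (insert x L - ?C)"
      using x unfolding homogeneous_split_def by auto
    then show ?thesis by blast
  qed
  show ?thesis
  proof (cases "\<forall>y\<in>L. E x y")
    case True
    then have "homogeneous_split (insert x L) E {x} L"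
      using AB x unfolding homogeneous_split_def by auto
    then show ?thesis by blast
  next
    case False
    then obtain y where "y \<in> A \<or> y \<in> B" "\<not> E x y"
      using AB by blast
    then show ?thesis
      using *[of A B y] *[of B A y] AB sym' by blast
  qed
qed

text \<open>Seinsche's theorem, by adding one vertex at a time. A split with all edges across has
  none across in the complement, so the extension step is applied there and its result carried
  back.\<close>

lemma P4_free_homogeneous_split:
  assumes "finite L" "2 \<le> card L" "P4_free_on L E" "symp E"
  shows "\<exists>A B. homogeneous_split L E A B"
  using assms
proof (induction L rule: finite_induct)
  case (insert x L)
  show ?case
  proof (cases "2 \<le> card L")
    case False
    then obtain y where y: "L = {y}"
      using insert.prems(1) insert.hyps card_1_singletonE[of L] by auto
    then have "homogeneous_split (insert x L) E {x} {y}"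
      using insert.hyps(2) unfolding homogeneous_split_def by auto
    then show ?thesis by blast
  next
    case True
    let ?F = "\<lambda>x y. x \<noteq> y \<and> \<not> E x y"
    have "P4_free_on L E"
      using insert.prems(2) by (rule P4_free_on_subset) blast
    then obtain A B where AB: "A \<noteq> {}" "B \<noteq> {}" "A \<union> B = L" "A \<inter> B = {}"
      and "(\<forall>a\<in>A. \<forall>b\<in>B. E a b) \<or> (\<forall>a\<in>A. \<forall>b\<in>B. \<not> E a b)"
      using insert.IH[OF True] insert.prems(3) unfolding homogeneous_split_def by blast
    then consider "\<forall>a\<in>A. \<forall>b\<in>B. \<not> E a b" | "\<forall>a\<in>A. \<forall>b\<in>B. \<not> ?F a b"
      by blast
    then show ?thesis
    proof cases
      case 1
      then show ?thesis
        using homogeneous_split_insert[OF insert.prems(2,3) insert.hyps(2) AB] by blast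
    next
      case 2
      have "symp ?F"
        using insert.prems(3) by (auto simp: symp_def)
      then have "\<exists>A B. homogeneous_split (insert x L) ?F A B"
        using homogeneous_split_insert[OF P4_free_on_complement[OF insert.prems(2,3)] _
            insert.hyps(2) AB 2] by blast
      then show ?thesis
        using homogeneous_split_complement by blast
    qed
  qed
qed simp

text \<open>Covers true and false twins: the pair \<open>u\<close>, \<open>v\<close> itself is left
  open, and its adjacency later decides between join and union.\<close>

definition twins :: "'a set \<Rightarrow> ('a \<Rightarrow> 'a \<Rightarrow> bool) \<Rightarrow> 'a \<Rightarrow> 'a \<Rightarrow> bool" where
  "twins L E u v \<longleftrightarrow> u \<in> L \<and> v \<in> L \<and> u \<noteq> v \<and> (\<forall>w\<in>L. w \<noteq> u \<longrightarrow> w \<noteq> v \<longrightarrow> E u w = E v w)"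

text \<open>A part of a homogeneous split with at least two vertices has twins by induction, and
  every vertex of the other part sees them alike. If both parts are singletons, their two vertices
  are twins.\<close>

lemma P4_free_twins:
  assumes "finite L" "2 \<le> card L" "P4_free_on L E" "symp E"
  shows "\<exists>u v. twins L E u v"
  using assms
proof (induction "card L" arbitrary: L rule: less_induct)
  case less
  obtain A B where AB: "A \<noteq> {}" "B \<noteq> {}" "A \<union> B = L" "A \<inter> B = {}"
    and hom: "(\<forall>a\<in>A. \<forall>b\<in>B. E a b) \<or> (\<forall>a\<in>A. \<forall>b\<in>B. \<not> E a b)"
    using P4_free_homogeneous_split[OF less.prems] unfolding homogeneous_split_def by blast
  have hom': "(\<forall>a\<in>A. \<forall>b\<in>B. E b a) \<or> (\<forall>a\<in>A. \<forall>b\<in>B. \<not> E b a)"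
    using hom less.prems(4) by (meson sympD)
  have *: "\<exists>u v. twins C E u v" if "2 \<le> card C" "C \<subset> L" for C
    using less.hyps[of C] that less.prems psubset_card_mono[of L C] finite_subset[of C L]
      P4_free_on_subset[of L E C] by blast
  consider "2 \<le> card A" | "2 \<le> card B" | "card A \<le> 1" "card B \<le> 1"
    by linarith
  then show ?case
  proof cases
    case 1
    then obtain u v where "twins A E u v"
      using *[of A] AB by blast
    then have "twins L E u v"
      using AB hom unfolding twins_def by blast
    then show ?thesis by blast
  next
    case 2
    then obtain u v where "twins B E u v"
      using *[of B] AB by blast
    then have "twins L E u v"
      using AB hom' unfolding twins_def by blast
    then show ?thesis by blast
  next
    case 3
    have "finite A" "finite B"
      using less.prems(1) AB by auto
    then have "card A = 1" "card B = 1"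
      using 3 AB by (auto simp: le_Suc_eq)
    then obtain u v where "A = {u}" "B = {v}"
      by (metis card_1_singletonE)
    then have "twins L E u v"
      using AB unfolding twins_def by auto
    then show ?thesis by blast
  qed
qed

section \<open>Independent sets in products\<close>

definition prod_independent ::
  "('a \<Rightarrow> 'a \<Rightarrow> bool) \<Rightarrow> ('b \<Rightarrow> 'b \<Rightarrow> bool) \<Rightarrow> ('a \<times> 'b) set \<Rightarrow> bool" where
  "prod_independent E F S \<longleftrightarrow> (\<forall>(a, b)\<in>S. \<forall>(a', b')\<in>S. \<not> (E a a' \<and> F b b'))"

text \<open>The independence number of the product restricted to the box
  \<open>A \<times> B\<close>. With \<open>E\<close> and \<open>F\<close> fixed, the recurrence
  varies only the sides of the box.\<close>

definition prod_alpha ::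
  "('a \<Rightarrow> 'a \<Rightarrow> bool) \<Rightarrow> ('b \<Rightarrow> 'b \<Rightarrow> bool) \<Rightarrow> 'a set \<Rightarrow> 'b set \<Rightarrow> nat" where
  "prod_alpha E F A B = Max (card ` {S. S \<subseteq> A \<times> B \<and> prod_independent E F S})"

lemma prod_independentD:
  "prod_independent E F S \<Longrightarrow> (a, b) \<in> S \<Longrightarrow> (a', b') \<in> S \<Longrightarrow> E a a' \<Longrightarrow> F b b' \<Longrightarrow> False"
  unfolding prod_independent_def by blast

lemma prod_independent_subset:
  "prod_independent E F S \<Longrightarrow> T \<subseteq> S \<Longrightarrow> prod_independent E F T"
  unfolding prod_independent_def by blast

lemma prod_alpha_ge:
  assumes "finite A" "finite B" "S \<subseteq> A \<times> B" "prod_independent E F S"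
  shows "card S \<le> prod_alpha E F A B"
  unfolding prod_alpha_def using assms by (intro Max_ge) auto

lemma prod_alpha_le:
  assumes "finite A" "finite B"
    and "\<And>S. S \<subseteq> A \<times> B \<Longrightarrow> prod_independent E F S \<Longrightarrow> card S \<le> k"
  shows "prod_alpha E F A B \<le> k"
proof -
  have "{} \<in> {S. S \<subseteq> A \<times> B \<and> prod_independent E F S}"
    by (simp add: prod_independent_def)
  then show ?thesis
    unfolding prod_alpha_def using assms by (intro Max.boundedI) auto
qed

lemma prod_alpha_attained:
  assumes "finite A" "finite B"
  obtains S where "S \<subseteq> A \<times> B" "prod_independent E F S" "card S = prod_alpha E F A B"
proof -
  have "{} \<in> {S. S \<subseteq> A \<times> B \<and> prod_independent E F S}"
    by (simp add: prod_independent_def)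
  then have "prod_alpha E F A B \<in> card ` {S. S \<subseteq> A \<times> B \<and> prod_independent E F S}"
    unfolding prod_alpha_def using assms by (intro Max_in) auto
  then show ?thesis
    using that by auto
qed

lemma prod_alpha_mono:
  assumes "finite A" "finite B" "A' \<subseteq> A" "B' \<subseteq> B"
  shows "prod_alpha E F A' B' \<le> prod_alpha E F A B"
proof -
  have fin: "finite A'" "finite B'"
    using assms finite_subset by auto
  obtain S where "S \<subseteq> A' \<times> B'" "prod_independent E F S" "card S = prod_alpha E F A' B'"
    using prod_alpha_attained[OF fin] by blast
  then show ?thesis
    using prod_alpha_ge[OF assms(1,2), of S E F] assms(3,4) by auto
qed

text \<open>Lets the rules be proved for the first factor only. The inner fact is polymorphic, so
  that both inequalities are instances of it.\<close>

lemma prod_alpha_swap: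
  assumes "finite A" "finite B"
  shows "prod_alpha F E B A = prod_alpha E F A B"
proof -
  have *: "prod_alpha E F A B \<le> prod_alpha F E B A" if fin: "finite A" "finite B"
    for A :: "'x set" and B :: "'y set" and E F
  proof -
    obtain S where S: "S \<subseteq> A \<times> B" "prod_independent E F S" "card S = prod_alpha E F A B"
      using prod_alpha_attained[OF fin] by blast
    have "prod_independent F E (prod.swap ` S)"
      using S(2) by (auto simp: prod_independent_def)
    then have "card (prod.swap ` S) \<le> prod_alpha F E B A"
      using S(1) fin by (intro prod_alpha_ge) auto
    then show ?thesis
      using S(3) by (simp add: card_image)
  qed
  show ?thesis
    using *[OF assms] *[OF assms(2,1)] by (rule order.antisym[rotated])
qed

section \<open>Recurrences for the independence number of a box\<close>

lemma prod_alpha_empty: "A = {} \<or> B = {} \<Longrightarrow> prod_alpha E F A B = 0"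
proof -
  assume "A = {} \<or> B = {}"
  then have "{S. S \<subseteq> A \<times> B \<and> prod_independent E F S} = {{}}"
    by (auto simp: prod_independent_def)
  then show ?thesis
    by (simp add: prod_alpha_def)
qed

text \<open>Without a loop at \<open>a\<close> no two pairs over \<open>a\<close> are adjacent, so
  the whole fibre is independent. This is why the trees carry leaf counts.\<close>

lemma prod_alpha_singleton:
  assumes "finite B" "\<not> E a a"
  shows "prod_alpha E F {a} B = card B"
proof (rule order.antisym)
  show "prod_alpha E F {a} B \<le> card B"
  proof (rule prod_alpha_le)
    fix S
    assume "S \<subseteq> {a} \<times> B"
    then show "card S \<le> card B"
      using card_mono[of "{a} \<times> B" S] assms(1) by (simp add: card_cartesian_product_singleton)
  qed (use assms in auto)
  have "card ({a} \<times> B) \<le> prod_alpha E F {a} B"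
    using assms by (intro prod_alpha_ge) (auto simp: prod_independent_def)
  then show "card B \<le> prod_alpha E F {a} B"
    by (simp add: card_cartesian_product_singleton)
qed

text \<open>An edge of the product needs an edge of \<open>E\<close>, so none runs between the two
  boxes, whatever \<open>F\<close> is: independent sets of the boxes can be united freely.\<close>

lemma prod_alpha_union:
  assumes fin: "finite A" "finite A'" "finite B" and disj: "A \<inter> A' = {}" and sym: "symp E"
    and no: "\<And>a a'. a \<in> A \<Longrightarrow> a' \<in> A' \<Longrightarrow> \<not> E a a'"
  shows "prod_alpha E F (A \<union> A') B = prod_alpha E F A B + prod_alpha E F A' B"
proof (rule order.antisym)
  show "prod_alpha E F (A \<union> A') B \<le> prod_alpha E F A B + prod_alpha E F A' B"
  proof (rule prod_alpha_le)
    fix S assume S: "S \<subseteq> (A \<union> A') \<times> B" "prod_independent E F S"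
    have "card S \<le> card (S \<inter> A \<times> B) + card (S \<inter> A' \<times> B)"
    proof -
      have "S = (S \<inter> A \<times> B) \<union> (S \<inter> A' \<times> B)"
        using S(1) by auto
      then show ?thesis
        by (metis card_Un_le)
    qed
    also have "\<dots> \<le> prod_alpha E F A B + prod_alpha E F A' B"
      using fin S(2) by (intro add_mono prod_alpha_ge) (auto intro: prod_independent_subset)
    finally show "card S \<le> prod_alpha E F A B + prod_alpha E F A' B" .
  qed (use fin in auto)
  obtain S where S: "S \<subseteq> A \<times> B" "prod_independent E F S" "card S = prod_alpha E F A B"
    using prod_alpha_attained[OF fin(1,3)] by blast
  obtain S' where S': "S' \<subseteq> A' \<times> B" "prod_independent E F S'" "card S' = prod_alpha E F A' B"
    using prod_alpha_attained[OF fin(2,3)] by blast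
  have no': "\<not> E a' a" if "a \<in> A" "a' \<in> A'" for a a'
    using no[OF that] sym by (auto dest: sympD)
  have "prod_independent E F (S \<union> S')"
    unfolding prod_independent_def
    using S(1) S'(1) no no' prod_independentD[OF S(2)] prod_independentD[OF S'(2)] by blast
  then have "card (S \<union> S') \<le> prod_alpha E F (A \<union> A') B"
    using S(1) S'(1) fin by (intro prod_alpha_ge) auto
  moreover have "card (S \<union> S') = card S + card S'"
    using S(1) S'(1) fin disj by (intro card_Un_disjoint) (auto dest: finite_subset)
  ultimately show "prod_alpha E F A B + prod_alpha E F A' B \<le> prod_alpha E F (A \<union> A') B"
    using S(3) S'(3) by simp
qed

lemma prod_alpha_join:
  assumes fin: "finite A" "finite A'" "finite B" "finite B'" and sym: "symp E" "symp F"
    and E: "\<And>a a'. a \<in> A \<Longrightarrow> a' \<in> A' \<Longrightarrow> E a a'" and F: "\<And>b b'. b \<in> B \<Longrightarrow> b' \<in> B' \<Longrightarrow> F b b'"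
  shows "prod_alpha E F (A \<union> A') (B \<union> B') =
    max (max (prod_alpha E F A (B \<union> B')) (prod_alpha E F A' (B \<union> B')))
        (max (prod_alpha E F (A \<union> A') B) (prod_alpha E F (A \<union> A') B'))" (is "?l = ?r")
proof (rule order.antisym)
  show "?r \<le> ?l"
    using fin by (intro max.boundedI prod_alpha_mono) auto
  show "?l \<le> ?r"
  proof (rule prod_alpha_le)
    fix S assume S: "S \<subseteq> (A \<union> A') \<times> (B \<union> B')" "prod_independent E F S"
    have F': "F b' b" if "b \<in> B" "b' \<in> B'" for b b'
      using F[OF that] sym(2) by (auto dest: sympD)
    \<comment> \<open>Opposite quadrants are completely joined, so \<open>S\<close> misses one of each opposite pair and
      therefore lies in a row or a column of quadrants.\<close>
    have "S \<inter> A \<times> B = {} \<or> S \<inter> A' \<times> B' = {}"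
      using prod_independentD[OF S(2)] E F by blast
    moreover have "S \<inter> A \<times> B' = {} \<or> S \<inter> A' \<times> B = {}"
      using prod_independentD[OF S(2)] E F' by blast
    ultimately have "S \<subseteq> A \<times> (B \<union> B') \<or> S \<subseteq> A' \<times> (B \<union> B') \<or>
        S \<subseteq> (A \<union> A') \<times> B \<or> S \<subseteq> (A \<union> A') \<times> B'"
      using S(1) by blast
    then show "card S \<le> ?r"
      using prod_alpha_ge[OF _ _ _ S(2)] fin by (auto simp: le_max_iff_disj)
  qed (use fin in auto)
qed

section \<open>The tensor product in terms of adjacency relations\<close>

lemma independence_number_tensor_product:
  "independence_number (tensor_product G H) =
    prod_alpha (\<lambda>u v. {u, v} \<in> edges G) (\<lambda>u v. {u, v} \<in> edges H) (verts G) (verts H)"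
proof -
  have adj: "{(g, h), (g', h')} \<in> edges (tensor_product G H) \<longleftrightarrow> {g, g'} \<in> edges G \<and> {h, h'} \<in> edges H"
    for g h g' h'
  proof
    assume "{(g, h), (g', h')} \<in> edges (tensor_product G H)"
    then obtain g1 g2 h1 h2 where "{(g, h), (g', h')} = {(g1, h1), (g2, h2)}"
      "{g1, g2} \<in> edges G" "{h1, h2} \<in> edges H"
      by (auto simp: tensor_product_def)
    \<comment> \<open>The two pairs may be matched crosswise; both factors then swap together, which
      unordered edges do not notice.\<close>
    then show "{g, g'} \<in> edges G \<and> {h, h'} \<in> edges H"
      by (auto simp: doubleton_eq_iff insert_commute)
  qed (auto simp: tensor_product_def)
  have "independent_set (tensor_product G H) S \<longleftrightarrow> S \<subseteq> verts G \<times> verts H \<and>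
      prod_independent (\<lambda>u v. {u, v} \<in> edges G) (\<lambda>u v. {u, v} \<in> edges H) S" for S
    unfolding independent_set_def prod_independent_def
    by (auto simp: adj) (auto simp: tensor_product_def)
  then show ?thesis
    by (simp add: independence_number_def prod_alpha_def)
qed

section \<open>Decomposition into twin classes\<close>

text \<open>The decomposition trees are kept as arrays indexed by node numbers, vertices being the nodes
  below \<open>n\<close>; \<open>S\<close> maps a node to the set of vertices below it. After \<open>k\<close> merges, \<open>L\<close> is the set
  of surviving representatives and \<open>cur\<close> sends each of them to the node of its class.\<close>

definition cotree ::
  "nat \<Rightarrow> (nat \<Rightarrow> nat \<Rightarrow> bool) \<Rightarrow> (nat \<Rightarrow> nat set) \<Rightarrow>
   (nat \<Rightarrow> nat) \<Rightarrow> (nat \<Rightarrow> nat) \<Rightarrow> (nat \<Rightarrow> nat) \<Rightarrow> (nat \<Rightarrow> nat) \<Rightarrow> nat \<Rightarrow> bool" where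
  "cotree n E S l r j c k \<longleftrightarrow>
     (\<forall>a<n. S a = {a}) \<and> (\<forall>a<n + k. finite (S a) \<and> c a = card (S a)) \<and>
     (\<forall>a. n \<le> a \<longrightarrow> a < n + k \<longrightarrow> l a < a \<and> r a < a \<and> S a = S (l a) \<union> S (r a) \<and>
        S (l a) \<inter> S (r a) = {} \<and> (\<forall>x\<in>S (l a). \<forall>y\<in>S (r a). E x y \<longleftrightarrow> j a \<noteq> 0))"

text \<open>The clause on \<open>n + k - 1\<close> keeps the newest node in use, which identifies
  the root once a single class is left. The last clause lets representatives answer for their
  classes.\<close>

definition twin_classes ::
  "nat \<Rightarrow> (nat \<Rightarrow> nat \<Rightarrow> bool) \<Rightarrow> nat set \<Rightarrow> (nat \<Rightarrow> nat set) \<Rightarrow> (nat \<Rightarrow> nat) \<Rightarrow> nat \<Rightarrow> bool" where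
  "twin_classes n E L S cur k \<longleftrightarrow>
     L \<subseteq> {..<n} \<and> card L + k = n \<and> (\<forall>v\<in>L. cur v < n + k) \<and> (\<exists>v\<in>L. cur v = n + k - 1) \<and>
     (\<Union>v\<in>L. S (cur v)) = {..<n} \<and>
     (\<forall>u\<in>L. \<forall>v\<in>L. u \<noteq> v \<longrightarrow> S (cur u) \<inter> S (cur v) = {} \<and>
        (\<forall>x\<in>S (cur u). \<forall>y\<in>S (cur v). E x y = E u v))"

text \<open>Every third representative sees the twins alike, so adjacency to the united class is
  still constant and is given by \<open>u\<close> alone.\<close>

lemma twin_classes_merge:
  assumes tc: "twin_classes n E L S cur k" and tw: "twins L E u v" and "symp E"
  shows "twin_classes n E (L - {v}) (S(n + k := S (cur u) \<union> S (cur v))) (cur(u := n + k)) (Suc k)"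
proof -
  let ?S = "S(n + k := S (cur u) \<union> S (cur v))" and ?cur = "cur(u := n + k)"
  have L: "L \<subseteq> {..<n}" "card L + k = n" and cur: "\<And>w. w \<in> L \<Longrightarrow> cur w < n + k"
    and un: "(\<Union>v\<in>L. S (cur v)) = {..<n}"
    and hom: "\<And>a b. a \<in> L \<Longrightarrow> b \<in> L \<Longrightarrow> a \<noteq> b \<Longrightarrow> S (cur a) \<inter> S (cur b) = {} \<and>
        (\<forall>x\<in>S (cur a). \<forall>y\<in>S (cur b). E x y = E a b)"
    using tc by (simp_all add: twin_classes_def)
  have uv: "u \<in> L" "v \<in> L" "u \<noteq> v"
    and tw': "\<And>w. w \<in> L \<Longrightarrow> w \<noteq> u \<Longrightarrow> w \<noteq> v \<Longrightarrow> E u w = E v w"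
    using tw by (simp_all add: twins_def)
  have sym: "E a b = E b a" for a b
    using \<open>symp E\<close> by (auto dest: sympD)
  have Su: "?S (?cur u) = S (cur u) \<union> S (cur v)"
    by simp
  have Sw: "?S (?cur w) = S (cur w)" if "w \<in> L" "w \<noteq> u" for w
    using cur[OF that(1)] that(2) by simp
  have "finite L"
    using L(1) finite_subset by blast
  then have card: "card (L - {v}) + Suc k = n"
    using L(2) uv(2) card_Suc_Diff1[of L v] by simp
  have lt: "?cur w < n + Suc k" if "w \<in> L - {v}" for w
    using cur[of w] that by auto
  have last: "\<exists>w\<in>L - {v}. ?cur w = n + Suc k - 1"
    using uv by (intro bexI[of _ u]) auto
  have un': "(\<Union>w\<in>L - {v}. ?S (?cur w)) = {..<n}"
  proof -
    have "(\<Union>w\<in>L - {v}. ?S (?cur w)) = ?S (?cur u) \<union> (\<Union>w\<in>L - {u, v}. ?S (?cur w))"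
      using uv by blast
    also have "(\<Union>w\<in>L - {u, v}. ?S (?cur w)) = (\<Union>w\<in>L - {u, v}. S (cur w))"
      using Sw by (intro SUP_cong) auto
    also have "?S (?cur u) \<union> (\<Union>w\<in>L - {u, v}. S (cur w)) = (\<Union>w\<in>L. S (cur w))"
      using uv unfolding Su by blast
    finally show ?thesis
      using un by simp
  qed
  have merged: "?S (?cur u) \<inter> ?S (?cur w) = {} \<and>
      (\<forall>x\<in>?S (?cur u). \<forall>y\<in>?S (?cur w). E x y = E u w)"
    if "w \<in> L" "w \<noteq> u" "w \<noteq> v" for w
    unfolding Su Sw[OF that(1,2)]
    using hom[OF uv(1) that(1)] hom[OF uv(2) that(1)] tw'[OF that] that by blast
  have hom': "?S (?cur a) \<inter> ?S (?cur b) = {} \<and>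
      (\<forall>x\<in>?S (?cur a). \<forall>y\<in>?S (?cur b). E x y = E a b)"
    if "a \<in> L - {v}" "b \<in> L - {v}" "a \<noteq> b" for a b
  proof (cases "a = u \<or> b = u")
    case True
    then show ?thesis
    proof
      assume "a = u"
      then show ?thesis using merged[of b] that by simp
    next
      assume b: "b = u"
      then have "?S (?cur u) \<inter> ?S (?cur a) = {}"
        "\<forall>x\<in>?S (?cur u). \<forall>y\<in>?S (?cur a). E x y = E u a"
        using merged[of a] that by simp_all
      then show ?thesis
        unfolding b using sym by blast
    qed
  next
    case False
    then show ?thesis
      using Sw[of a] Sw[of b] hom[of a b] that by simp
  qed
  have sub: "L - {v} \<subseteq> {..<n}"
    using L(1) by blast
  show ?thesis
    unfolding twin_classes_def
    by (intro conjI ballI impI)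
      (fact sub card lt last un' conjunct1[OF hom'] hom'[THEN conjunct2, rule_format])+
qed

text \<open>Adjacency between two classes is that of their representatives, so one look at
  \<open>E u v\<close> labels the new node.\<close>

lemma cotree_merge:
  assumes ct: "cotree n E S l r j c k" and tc: "twin_classes n E L S cur k"
    and uv: "u \<in> L" "v \<in> L" "u \<noteq> v"
  shows "cotree n E (S(n + k := S (cur u) \<union> S (cur v))) (l(n + k := cur u)) (r(n + k := cur v))
    (j(n + k := of_bool (E u v))) (c(n + k := c (cur u) + c (cur v))) (Suc k)"
proof -
  let ?S = "S(n + k := S (cur u) \<union> S (cur v))"
  have cur: "cur u < n + k" "cur v < n + k"
    and hom: "S (cur u) \<inter> S (cur v) = {}" "\<And>x y. x \<in> S (cur u) \<Longrightarrow> y \<in> S (cur v) \<Longrightarrow> E x y = E u v"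
    using tc uv by (simp_all add: twin_classes_def)
  have leaf: "S a = {a}" if "a < n" for a
    using ct that by (simp add: cotree_def)
  have fin: "finite (S a)" "c a = card (S a)" if "a < n + k" for a
    using ct that by (simp_all add: cotree_def)
  have node: "l a < a \<and> r a < a \<and> S a = S (l a) \<union> S (r a) \<and>
        S (l a) \<inter> S (r a) = {} \<and> (\<forall>x\<in>S (l a). \<forall>y\<in>S (r a). E x y \<longleftrightarrow> j a \<noteq> 0)"
    if "n \<le> a" "a < n + k" for a
    using ct that by (simp add: cotree_def)
  have card: "card (S (cur u) \<union> S (cur v)) = c (cur u) + c (cur v)"
    using fin cur hom(1) by (simp add: card_Un_disjoint)
  show ?thesis
    unfolding cotree_def
  proof (intro conjI allI impI ballI)
    fix a assume a: "n \<le> a" "a < n + Suc k"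
    let ?l = "l(n + k := cur u)" and ?r = "r(n + k := cur v)" and ?j = "j(n + k := of_bool (E u v))"
    have *: "?l a < a \<and> ?r a < a \<and> ?S a = ?S (?l a) \<union> ?S (?r a) \<and>
        ?S (?l a) \<inter> ?S (?r a) = {} \<and> (\<forall>x\<in>?S (?l a). \<forall>y\<in>?S (?r a). E x y \<longleftrightarrow> ?j a \<noteq> 0)"
    proof (cases "a = n + k")
      case True
      then show ?thesis
        using cur hom by auto
    next
      case False
      then have "a < n + k"
        using a(2) by simp
      note node = node[OF a(1) this]
      then have "l a \<noteq> n + k" "r a \<noteq> n + k"
        using \<open>a < n + k\<close> by auto
      then show ?thesis
        using node False by simp
    qed
    then show "?l a < a" "?r a < a" "?S a = ?S (?l a) \<union> ?S (?r a)" "?S (?l a) \<inter> ?S (?r a) = {}"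
      by simp_all
    fix x y assume "x \<in> ?S (?l a)" "y \<in> ?S (?r a)"
    then show "E x y \<longleftrightarrow> ?j a \<noteq> 0"
      using * by simp
  qed (use leaf fin cur card in \<open>auto simp: less_Suc_eq\<close>)
qed

text \<open>One class remains after \<open>n - 1\<close> merges, and the newest node must be its
  node. For \<open>n = 1\<close> that is the vertex 0 itself.\<close>

lemma twin_classes_final:
  assumes "twin_classes n E L S cur (n - 1)" "0 < n"
  shows "S (2 * n - 2) = {..<n}"
proof -
  have *: "card L + (n - 1) = n" "\<exists>v\<in>L. cur v = n + (n - 1) - 1" "(\<Union>v\<in>L. S (cur v)) = {..<n}"
    using assms(1) unfolding twin_classes_def by - (elim conjE, assumption)+
  then have "card L = 1"
    using assms(2) by simp
  then obtain v where "L = {v}"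
    by (rule card_1_singletonE)
  then have "cur v = n + (n - 1) - 1" "S (cur v) = {..<n}"
    using *(2,3) by simp_all
  moreover have "n + (n - 1) - 1 = 2 * n - 2"
    by simp
  ultimately show ?thesis
    by simp
qed

text \<open>A union node is split whatever the other factor is, so only two joins call for the rule
  with four terms. At a leaf the value is the leaf count of the other node.\<close>

lemma prod_alpha_cotree:
  assumes A: "cotree n E S l r j c k" and B: "cotree m F R l' r' j' c' k'"
    and sym: "symp E" "symp F" and irr: "\<And>v. \<not> E v v" "\<And>v. \<not> F v v"
    and a: "a < n + k" and b: "b < m + k'"
  shows "prod_alpha E F (S a) (R b) =
    (if a < n then c' b
     else if b < m then c a
     else if j a = 0 then prod_alpha E F (S (l a)) (R b) + prod_alpha E F (S (r a)) (R b)
     else if j' b = 0 then prod_alpha E F (S a) (R (l' b)) + prod_alpha E F (S a) (R (r' b))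
     else max (max (prod_alpha E F (S (l a)) (R b)) (prod_alpha E F (S (r a)) (R b)))
              (max (prod_alpha E F (S a) (R (l' b))) (prod_alpha E F (S a) (R (r' b)))))"
proof -
  have finA: "finite (S a')" if "a' < n + k" for a'
    using A that by (simp add: cotree_def)
  have finB: "finite (R b')" if "b' < m + k'" for b'
    using B that by (simp add: cotree_def)
  have leafA: "S a = {a}" if "a < n"
    using A that by (simp add: cotree_def)
  have leafB: "R b = {b}" if "b < m"
    using B that by (simp add: cotree_def)
  have cA: "c a = card (S a)" and cB: "c' b = card (R b)"
    using A B a b by (simp_all add: cotree_def)
  have nodeA: "l a < a" "r a < a" "S a = S (l a) \<union> S (r a)" "S (l a) \<inter> S (r a) = {}"
    "\<And>x y. x \<in> S (l a) \<Longrightarrow> y \<in> S (r a) \<Longrightarrow> E x y \<longleftrightarrow> j a \<noteq> 0" if "\<not> a < n"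
    using A a that by (simp_all add: cotree_def)
  have nodeB: "l' b < b" "r' b < b" "R b = R (l' b) \<union> R (r' b)" "R (l' b) \<inter> R (r' b) = {}"
    "\<And>x y. x \<in> R (l' b) \<Longrightarrow> y \<in> R (r' b) \<Longrightarrow> F x y \<longleftrightarrow> j' b \<noteq> 0" if "\<not> b < m"
    using B b that by (simp_all add: cotree_def)
  consider "a < n" | "\<not> a < n" "b < m" | "\<not> a < n" "\<not> b < m" "j a = 0"
    | "\<not> a < n" "\<not> b < m" "j a \<noteq> 0" "j' b = 0" | "\<not> a < n" "\<not> b < m" "j a \<noteq> 0" "j' b \<noteq> 0"
    by blast
  then show ?thesis
  proof cases
    case 1
    then show ?thesis
      using leafA cB prod_alpha_singleton[OF finB[OF b], of E a F] irr by simp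
  next
    case 2
    then show ?thesis
      using leafB cA prod_alpha_singleton[OF finA[OF a], of F b E] irr
        prod_alpha_swap[OF finA[OF a] finB[OF b], of F E] by simp
  next
    case 3
    have "finite (S (l a))" "finite (S (r a))"
      using finA nodeA(1,2)[OF 3(1)] a by simp_all
    then have "prod_alpha E F (S (l a) \<union> S (r a)) (R b) =
        prod_alpha E F (S (l a)) (R b) + prod_alpha E F (S (r a)) (R b)"
      using nodeA(4,5)[OF 3(1)] 3(3) finB[OF b] sym(1) by (intro prod_alpha_union) auto
    then show ?thesis
      using 3 nodeA(3)[OF 3(1)] by simp
  next
    case 4
    have fin: "finite (R (l' b))" "finite (R (r' b))"
      using finB nodeB(1,2)[OF 4(2)] b by simp_all
    \<comment> \<open>A union in the second factor is the union rule with the factors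
      exchanged.\<close>
    then have "prod_alpha F E (R (l' b) \<union> R (r' b)) (S a) =
        prod_alpha F E (R (l' b)) (S a) + prod_alpha F E (R (r' b)) (S a)"
      using nodeB(4,5)[OF 4(2)] 4(4) finA[OF a] sym(2) by (intro prod_alpha_union) auto
    then have "prod_alpha E F (S a) (R (l' b) \<union> R (r' b)) =
        prod_alpha E F (S a) (R (l' b)) + prod_alpha E F (S a) (R (r' b))"
      unfolding prod_alpha_swap[OF finA[OF a] fin(1), of F E] prod_alpha_swap[OF finA[OF a] fin(2), of F E]
        prod_alpha_swap[OF finA[OF a] finite_UnI[OF fin], of F E] .
    then show ?thesis
      using 4 nodeB(3)[OF 4(2)] by simp
  next
    case 5
    have "finite (S (l a))" "finite (S (r a))" "finite (R (l' b))" "finite (R (r' b))"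
      using finA finB nodeA(1,2)[OF 5(1)] nodeB(1,2)[OF 5(2)] a b by simp_all
    then have "prod_alpha E F (S (l a) \<union> S (r a)) (R (l' b) \<union> R (r' b)) =
      max (max (prod_alpha E F (S (l a)) (R (l' b) \<union> R (r' b)))
               (prod_alpha E F (S (r a)) (R (l' b) \<union> R (r' b))))
          (max (prod_alpha E F (S (l a) \<union> S (r a)) (R (l' b)))
               (prod_alpha E F (S (l a) \<union> S (r a)) (R (r' b))))"
      using nodeA(5)[OF 5(1)] nodeB(5)[OF 5(2)] 5(3,4) sym by (intro prod_alpha_join) auto
    then show ?thesis
      using 5 nodeA(3)[OF 5(1)] nodeB(3)[OF 5(2)] by simp
  qed
qed

section \<open>A language of bounded loops\<close>

datatype 'v expr =
    Num nat
  | Cell 'v "'v expr"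
  | Input "'v expr"
  | Plus "'v expr" "'v expr"
  | Minus "'v expr" "'v expr"

datatype 'v com =
    Skip
  | Assign 'v "'v expr" "'v expr"
  | Seq "'v com" "'v com"
  | Cond "'v expr" "'v com" "'v com"
  | For 'v "'v com"

type_synonym 'v store = "'v \<Rightarrow> nat \<Rightarrow> nat"

text \<open>Reads past the end give 0, as for the machine instruction \<open>Read\<close>, so
  expressions can be evaluated outside their meaningful range.\<close>

definition input_at :: "nat list \<Rightarrow> nat \<Rightarrow> nat" where
  "input_at x i = (if i < length x then x ! i else 0)"

primrec eval :: "nat list \<Rightarrow> 'v store \<Rightarrow> 'v expr \<Rightarrow> nat" where
  "eval x s (Num k) = k"
| "eval x s (Cell v e) = s v (eval x s e)"
| "eval x s (Input e) = input_at x (eval x s e)"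
| "eval x s (Plus a b) = eval x s a + eval x s b"
| "eval x s (Minus a b) = eval x s a - eval x s b"

definition upd :: "'v store \<Rightarrow> 'v \<Rightarrow> nat \<Rightarrow> nat \<Rightarrow> 'v store" where
  "upd s v i a = s(v := (s v)(i := a))"

text \<open>The counter cell is rewritten from \<open>k\<close> in each round, so a body that
  overwrites it cannot change the number of rounds.\<close>

primrec run :: "nat list \<Rightarrow> nat \<Rightarrow> 'v com \<Rightarrow> 'v store \<Rightarrow> 'v store" where
  "run x N Skip s = s"
| "run x N (Assign v i e) s = upd s v (eval x s i) (eval x s e)"
| "run x N (Seq c d) s = run x N d (run x N c s)"
| "run x N (Cond e c d) s = (if eval x s e \<noteq> 0 then run x N c s else run x N d s)"
| "run x N (For v c) s = rec_nat s (\<lambda>k s'. run x N c (upd s' v 0 k)) N"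

lemma run_For_invariant:
  assumes "I 0 s"
    and "\<And>k s. k < N \<Longrightarrow> I k s \<Longrightarrow> I (Suc k) (run x N c (upd s v 0 k))"
  shows "I N (run x N (For v c) s)"
proof -
  have "I j (rec_nat s (\<lambda>k s'. run x N c (upd s' v 0 k)) j)" if "j \<le> N" for j
    using that by (induction j) (auto intro: assms)
  then show ?thesis
    by simp
qed

primrec written :: "'v com \<Rightarrow> 'v set" where
  "written Skip = {}"
| "written (Assign v i e) = {v}"
| "written (Seq c d) = written c \<union> written d"
| "written (Cond e c d) = written c \<union> written d"
| "written (For v c) = insert v (written c)"

text \<open>The frame rule, used for everything that a subprogram cannot touch.\<close>

lemma run_not_written: "v \<notin> written c \<Longrightarrow> run x N c s v = s v"
proof (induction c arbitrary: s)
  case (For u c)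
  have "rec_nat s (\<lambda>k s'. run x N c (upd s' u 0 k)) j v = s v" for j
    using For by (induction j) (auto simp: upd_def)
  then show ?case
    by simp
qed (auto simp: upd_def)

section \<open>Compilation to the random access machine\<close>

text \<open>An upper bound instead of an exact count, so that branches of different lengths can
  share one bound.\<close>

definition reaches :: "instr list \<Rightarrow> nat list \<Rightarrow> nat \<Rightarrow> ram_state \<Rightarrow> ram_state \<Rightarrow> bool" where
  "reaches P x t s s' \<longleftrightarrow> (\<exists>k\<le>t. (ram_step P x ^^ k) s = s')"

lemma reaches_0 [simp]: "reaches P x 0 s s' \<longleftrightarrow> s' = s"
  by (auto simp: reaches_def)

lemma reaches_trans:
  assumes "reaches P x t s s'" "reaches P x u s' s''"
  shows "reaches P x (t + u) s s''"
proof -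
  from assms obtain j k where "j \<le> t" "(ram_step P x ^^ j) s = s'"
    "k \<le> u" "(ram_step P x ^^ k) s' = s''"
    by (auto simp: reaches_def)
  then show ?thesis
    unfolding reaches_def by (intro exI[of _ "k + j"]) (simp add: funpow_add)
qed

lemma reaches_mono: "reaches P x t s s' \<Longrightarrow> t \<le> u \<Longrightarrow> reaches P x u s s'"
  unfolding reaches_def using le_trans by blast

lemma reaches_step:
  assumes "pc < length P" "reaches P x t (exec_instr x (P ! pc) (pc, M)) s'"
  shows "reaches P x (Suc t) (pc, M) s'"
proof -
  have "reaches P x 1 (pc, M) (exec_instr x (P ! pc) (pc, M))"
    unfolding reaches_def using assms(1) by (intro exI[of _ 1]) (simp add: ram_step_def)
  from reaches_trans[OF this assms(2)] show ?thesis
    by simp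
qed

section \<open>Code placement and register demand\<close>

fun code_at :: "instr list \<Rightarrow> nat \<Rightarrow> instr list \<Rightarrow> bool" where
  "code_at P pc [] \<longleftrightarrow> True"
| "code_at P pc (i # c) \<longleftrightarrow> pc < length P \<and> P ! pc = i \<and> code_at P (Suc pc) c"

lemma code_at_append [simp]:
  "code_at P pc (c @ d) \<longleftrightarrow> code_at P pc c \<and> code_at P (pc + length c) d"
  by (induction c arbitrary: pc) auto

lemma code_at_middle: "code_at (a @ c @ b) (length a) c"
proof (induction c arbitrary: a)
  case (Cons i c)
  show ?case
    using Cons[of "a @ [i]"] by simp
qed simp

text \<open>The number of consecutive scratch registers in use. A cell takes two, since its address
  is computed with a constant in the next register; a second operand starts one register
  higher.\<close>

primrec expr_depth :: "'v expr \<Rightarrow> nat" where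
  "expr_depth (Num k) = 1"
| "expr_depth (Cell v e) = max 2 (expr_depth e)"
| "expr_depth (Input e) = expr_depth e"
| "expr_depth (Plus a b) = max (expr_depth a) (Suc (expr_depth b))"
| "expr_depth (Minus a b) = max (expr_depth a) (Suc (expr_depth b))"

lemma expr_depth_pos: "0 < expr_depth e"
  by (induction e) auto

primrec com_depth :: "'v com \<Rightarrow> nat" where
  "com_depth Skip = 0"
| "com_depth (Assign v i e) = max 2 (max (expr_depth i) (Suc (expr_depth e)))"
| "com_depth (Seq c b) = max (com_depth c) (com_depth b)"
| "com_depth (Cond e c b) = max (expr_depth e) (max (com_depth c) (com_depth b))"
| "com_depth (For v c) = max 2 (Suc (com_depth c))"

text \<open>Addresses below \<open>2 ^ q\<close> are machine registers; entry \<open>i\<close> of the variable \<open>v\<close> lives at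
  \<open>address v i\<close>. Register 1 holds the loop bound \<open>N\<close>, and code compiled at depth \<open>d\<close> leaves
  the registers below \<open>d\<close> alone.\<close>

locale layout =
  fixes num :: "'v \<Rightarrow> nat" and q :: nat
  assumes num_inj: "inj num" and num_less: "num v < 2 ^ q"
begin

text \<open>Unbounded arrays are interleaved: the residue modulo \<open>2 ^ q\<close> names the
  variable, the quotient the entry. With a power of two as stride, \<open>q\<close> doublings
  replace a multiplication.\<close>

definition address :: "'v \<Rightarrow> nat \<Rightarrow> nat" where
  "address v i = 2 ^ q * Suc i + num v"

lemma address_ge: "2 ^ q \<le> address v i"
  by (simp add: address_def)

lemma address_eq_iff [simp]: "address v i = address w j \<longleftrightarrow> v = w \<and> i = j"
proof
  assume eq: "address v i = address w j"
  have "address v i mod 2 ^ q = num v" "address v i div 2 ^ q = Suc i" for v i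
    using num_less[of v] by (simp_all add: address_def del: mult_Suc_right)
  then have "num v = num w" "Suc i = Suc j"
    using eq by metis+
  then show "v = w \<and> i = j"
    using num_inj by (auto dest: injD)
qed simp

definition stores :: "(nat \<Rightarrow> nat) \<Rightarrow> 'v store \<Rightarrow> bool" where
  "stores M s \<longleftrightarrow> (\<forall>v i. M (address v i) = s v i)"

lemma stores_cong:
  "stores M s \<Longrightarrow> (\<And>a. 2 ^ q \<le> a \<Longrightarrow> M' a = M a) \<Longrightarrow> stores M' s"
  using address_ge by (simp add: stores_def)

lemma stores_upd: "stores M s \<Longrightarrow> stores (M(address v i := a)) (upd s v i a)"
  by (auto simp: stores_def upd_def)

section \<open>Compiling expressions\<close>

definition address_code :: "nat \<Rightarrow> 'v \<Rightarrow> instr list" where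
  "address_code d v =
     [Const (Suc d) 1, Add d d (Suc d)] @ replicate q (Add d d d) @
     [Const (Suc d) (num v), Add d d (Suc d)]"

primrec expr_code :: "nat \<Rightarrow> 'v expr \<Rightarrow> instr list" where
  "expr_code d (Num k) = [Const d k]"
| "expr_code d (Cell v e) = expr_code d e @ address_code d v @ [Load d d]"
| "expr_code d (Input e) = expr_code d e @ [Read d d]"
| "expr_code d (Plus a b) = expr_code d a @ expr_code (Suc d) b @ [Add d d (Suc d)]"
| "expr_code d (Minus a b) = expr_code d a @ expr_code (Suc d) b @ [Sub d d (Suc d)]"

lemma reaches_doubling:
  assumes "code_at P pc (replicate k (Add d d d))" "M' = M(d := 2 ^ k * M d)"
  shows "reaches P x k (pc, M) (pc + k, M')"
  using assms
proof (induction k arbitrary: pc M)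
  case (Suc k)
  have "reaches P x k (Suc pc, M(d := M d + M d)) (Suc pc + k, M')"
    using Suc.prems by (intro Suc.IH) (auto simp: fun_eq_iff algebra_simps)
  then show ?case
    using Suc.prems(1) by (intro reaches_step) simp_all
qed simp

lemma address_code_correct:
  assumes "code_at P pc (address_code d v)"
  obtains M' where
    "reaches P x (length (address_code d v)) (pc, M) (pc + length (address_code d v), M')"
    "M' d = address v (M d)" "\<And>a. a \<noteq> d \<Longrightarrow> a \<noteq> Suc d \<Longrightarrow> M' a = M a"
proof -
  let ?M1 = "M(Suc d := 1, d := Suc (M d))"
  let ?M2 = "?M1(d := 2 ^ q * ?M1 d)"
  let ?M3 = "?M2(Suc d := num v, d := address v (M d))"
  have 1: "reaches P x 2 (pc, M) (pc + 2, ?M1)"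
    using assms unfolding numeral_2_eq_2 address_code_def
    by (auto intro!: reaches_step)
  have 2: "reaches P x q (pc + 2, ?M1) (pc + 2 + q, ?M2)"
    using assms by (intro reaches_doubling[where d = d]) (simp_all add: address_code_def)
  have 3: "reaches P x 2 (pc + 2 + q, ?M2) (pc + (2 + q + 2), ?M3)"
    using assms unfolding numeral_2_eq_2 address_code_def
    by (auto intro!: reaches_step simp: address_def fun_upd_twist numeral_eq_Suc)
  note reaches_trans[OF reaches_trans[OF 1 2] 3]
  moreover have "length (address_code d v) = 2 + q + 2"
    by (simp add: address_code_def)
  ultimately show ?thesis
    by (intro that[of ?M3]) simp_all
qed

text \<open>Pending operands lie below \<open>d\<close> and variables from \<open>2 ^ q\<close> on.
  Preserving both is what the induction needs when a second operand is evaluated.\<close>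

lemma expr_code_correct:
  assumes "code_at P pc (expr_code d e)" "d + expr_depth e \<le> 2 ^ q" "stores M s"
  shows "\<exists>M'. reaches P x (length (expr_code d e)) (pc, M) (pc + length (expr_code d e), M') \<and>
    M' d = eval x s e \<and> (\<forall>a. a < d \<or> 2 ^ q \<le> a \<longrightarrow> M' a = M a)"
  using assms
proof (induction e arbitrary: pc d M)
  case (Num k)
  let ?M = "M(d := k)"
  have "reaches P x (length (expr_code d (Num k))) (pc, M) (pc + length (expr_code d (Num k)), ?M)"
    using Num.prems(1) by (auto intro!: reaches_step)
  moreover have "?M d = eval x s (Num k)" "\<forall>a. a < d \<or> 2 ^ q \<le> a \<longrightarrow> ?M a = M a"
    using Num.prems(2) by auto
  ultimately show ?case
    by blast
next
  case (Cell v e)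
  let ?c = "expr_code d e" and ?a = "address_code d v"
  have code: "code_at P pc ?c" "code_at P (pc + length ?c) ?a"
    and depth: "d + expr_depth e \<le> 2 ^ q" "Suc d < 2 ^ q"
    using Cell.prems(1,2) by auto
  obtain M1 where 1: "reaches P x (length ?c) (pc, M) (pc + length ?c, M1)"
    "M1 d = eval x s e" "\<forall>a. a < d \<or> 2 ^ q \<le> a \<longrightarrow> M1 a = M a"
    using Cell.IH[OF code(1) depth(1) Cell.prems(3)] by blast
  obtain M2 where 2: "reaches P x (length ?a) (pc + length ?c, M1) (pc + length ?c + length ?a, M2)"
    "M2 d = address v (M1 d)" "\<And>a. a \<noteq> d \<Longrightarrow> a \<noteq> Suc d \<Longrightarrow> M2 a = M1 a"
    using address_code_correct[OF code(2)] by blast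
  have st: "stores M2 s"
    using 1(3) 2(3) depth by (intro stores_cong[OF Cell.prems(3)]) auto
  let ?M3 = "M2(d := M2 (M2 d))"
  have "reaches P x 1 (pc + length ?c + length ?a, M2) (Suc (pc + length ?c + length ?a), ?M3)"
    using Cell.prems(1) unfolding One_nat_def by (auto intro!: reaches_step simp: add.assoc)
  from reaches_trans[OF reaches_trans[OF 1(1) 2(1)] this]
  have "reaches P x (length (expr_code d (Cell v e))) (pc, M)
      (pc + length (expr_code d (Cell v e)), ?M3)"
    by (simp add: add.assoc)
  moreover have "?M3 d = eval x s (Cell v e)"
    using st 1(2) 2(2) by (simp add: stores_def)
  moreover have "\<forall>a. a < d \<or> 2 ^ q \<le> a \<longrightarrow> ?M3 a = M a"
    using 1(3) 2(3) depth by auto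
  ultimately show ?case
    by blast
next
  case (Input e)
  let ?c = "expr_code d e"
  have code: "code_at P pc ?c" and depth: "d + expr_depth e \<le> 2 ^ q"
    using Input.prems(1,2) by auto
  obtain M1 where 1: "reaches P x (length ?c) (pc, M) (pc + length ?c, M1)"
    "M1 d = eval x s e" "\<forall>a. a < d \<or> 2 ^ q \<le> a \<longrightarrow> M1 a = M a"
    using Input.IH[OF code depth Input.prems(3)] by blast
  let ?M2 = "M1(d := input_at x (M1 d))"
  have "reaches P x 1 (pc + length ?c, M1) (Suc (pc + length ?c), ?M2)"
    using Input.prems(1) unfolding One_nat_def
    by (auto intro!: reaches_step simp: input_at_def)
  from reaches_trans[OF 1(1) this]
  have "reaches P x (length (expr_code d (Input e))) (pc, M)
      (pc + length (expr_code d (Input e)), ?M2)"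
    by simp
  moreover have "?M2 d = eval x s (Input e)" "\<forall>a. a < d \<or> 2 ^ q \<le> a \<longrightarrow> ?M2 a = M a"
    using 1(2,3) depth expr_depth_pos[of e] by auto
  ultimately show ?case
    by blast
next
  case (Plus e f)
  let ?c = "expr_code d e" and ?b = "expr_code (Suc d) f"
  have code: "code_at P pc ?c" "code_at P (pc + length ?c) ?b"
    and depth: "d + expr_depth e \<le> 2 ^ q" "Suc d + expr_depth f \<le> 2 ^ q"
    using Plus.prems(1,2) by auto
  obtain M1 where 1: "reaches P x (length ?c) (pc, M) (pc + length ?c, M1)"
    "M1 d = eval x s e" "\<forall>a. a < d \<or> 2 ^ q \<le> a \<longrightarrow> M1 a = M a"
    using Plus.IH(1)[OF code(1) depth(1) Plus.prems(3)] by blast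
  have "stores M1 s"
    using 1(3) by (intro stores_cong[OF Plus.prems(3)]) simp
  then obtain M2 where 2:
    "reaches P x (length ?b) (pc + length ?c, M1) (pc + length ?c + length ?b, M2)"
    "M2 (Suc d) = eval x s f" "\<forall>a. a < Suc d \<or> 2 ^ q \<le> a \<longrightarrow> M2 a = M1 a"
    using Plus.IH(2)[OF code(2) depth(2)] by blast
  let ?M3 = "M2(d := M2 d + M2 (Suc d))"
  have "reaches P x 1 (pc + length ?c + length ?b, M2) (Suc (pc + length ?c + length ?b), ?M3)"
    using Plus.prems(1) unfolding One_nat_def by (auto intro!: reaches_step simp: add.assoc)
  from reaches_trans[OF reaches_trans[OF 1(1) 2(1)] this]
  have "reaches P x (length (expr_code d (Plus e f))) (pc, M)
      (pc + length (expr_code d (Plus e f)), ?M3)"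
    by (simp add: add.assoc)
  moreover have "?M3 d = eval x s (Plus e f)" "\<forall>a. a < d \<or> 2 ^ q \<le> a \<longrightarrow> ?M3 a = M a"
    using 1(2,3) 2(2,3) depth by auto
  ultimately show ?case
    by blast
next
  case (Minus e f)
  let ?c = "expr_code d e" and ?b = "expr_code (Suc d) f"
  have code: "code_at P pc ?c" "code_at P (pc + length ?c) ?b"
    and depth: "d + expr_depth e \<le> 2 ^ q" "Suc d + expr_depth f \<le> 2 ^ q"
    using Minus.prems(1,2) by auto
  obtain M1 where 1: "reaches P x (length ?c) (pc, M) (pc + length ?c, M1)"
    "M1 d = eval x s e" "\<forall>a. a < d \<or> 2 ^ q \<le> a \<longrightarrow> M1 a = M a"
    using Minus.IH(1)[OF code(1) depth(1) Minus.prems(3)] by blast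
  have "stores M1 s"
    using 1(3) by (intro stores_cong[OF Minus.prems(3)]) simp
  then obtain M2 where 2:
    "reaches P x (length ?b) (pc + length ?c, M1) (pc + length ?c + length ?b, M2)"
    "M2 (Suc d) = eval x s f" "\<forall>a. a < Suc d \<or> 2 ^ q \<le> a \<longrightarrow> M2 a = M1 a"
    using Minus.IH(2)[OF code(2) depth(2)] by blast
  let ?M3 = "M2(d := M2 d - M2 (Suc d))"
  have "reaches P x 1 (pc + length ?c + length ?b, M2) (Suc (pc + length ?c + length ?b), ?M3)"
    using Minus.prems(1) unfolding One_nat_def by (auto intro!: reaches_step simp: add.assoc)
  from reaches_trans[OF reaches_trans[OF 1(1) 2(1)] this]
  have "reaches P x (length (expr_code d (Minus e f))) (pc, M)
      (pc + length (expr_code d (Minus e f)), ?M3)"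
    by (simp add: add.assoc)
  moreover have "?M3 d = eval x s (Minus e f)" "\<forall>a. a < d \<or> 2 ^ q \<le> a \<longrightarrow> ?M3 a = M a"
    using 1(2,3) 2(2,3) depth by auto
  ultimately show ?case
    by blast
qed

text \<open>Jump targets are absolute, hence the position \<open>pc\<close>. In a loop, register
  \<open>d\<close> counts rounds; register 1 minus \<open>d\<close>, truncated, is zero once
  \<open>N\<close> rounds are done. Since \<open>address v 0\<close> is a compile-time constant,
  adding zero copies the counter there. Five instructions precede the body and three follow
  it.\<close>

primrec com_code :: "nat \<Rightarrow> nat \<Rightarrow> 'v com \<Rightarrow> instr list" where
  "com_code pc d Skip = []"
| "com_code pc d (Assign v i e) =
     expr_code d i @ address_code d v @ expr_code (Suc d) e @ [Store d (Suc d)]"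
| "com_code pc d (Seq c b) =
     (let c' = com_code pc d c in c' @ com_code (pc + length c') d b)"
| "com_code pc d (Cond e c b) =
     (let e' = expr_code d e;
          c' = com_code (pc + length e' + 1) d c;
          pc' = pc + length e' + length c' + 2;
          b' = com_code pc' d b
      in e' @ [JumpZero d pc'] @ c' @ [Jump (pc' + length b')] @ b')"
| "com_code pc d (For v c) =
     (let c' = com_code (pc + 5) (Suc d) c
      in [Const d 0,
          Sub (Suc d) 1 d, JumpZero (Suc d) (pc + length c' + 8),
          Const (Suc d) 0, Add (address v 0) d (Suc d)] @ c' @
         [Const (Suc d) 1, Add d d (Suc d), Jump (pc + 1)])"

text \<open>A polynomial in the loop bound. Both branches of a conditional are added, as a maximum
  of polynomials need not be one. A loop takes 1 step to start and 2 for the last test; a round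
  takes 4 before the body and 3 after it. Code length does not depend on the base register, here
  2.\<close>

primrec com_time :: "'v com \<Rightarrow> nat poly" where
  "com_time Skip = 0"
| "com_time (Assign v i e) = [:length (expr_code 2 i) + length (expr_code 2 e) + q + 5:]"
| "com_time (Seq c b) = com_time c + com_time b"
| "com_time (Cond e c b) = [:length (expr_code 2 e) + 2:] + com_time c + com_time b"
| "com_time (For v c) = [:3:] + [:0, 1:] * ([:7:] + com_time c)"

lemma length_address_code: "length (address_code d v) = q + 4"
  by (simp add: address_code_def)

lemma length_expr_code: "length (expr_code d e) = length (expr_code d' e)"
proof (induction e arbitrary: d d')
  case (Cell v e)
  from Cell[of d d'] show ?case by (simp add: length_address_code)
next
  case (Input e)
  from Input[of d d'] show ?case by simp
next
  case (Plus a b)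
  from Plus(1)[of d d'] Plus(2)[of "Suc d" "Suc d'"] show ?case by simp
next
  case (Minus a b)
  from Minus(1)[of d d'] Minus(2)[of "Suc d" "Suc d'"] show ?case by simp
qed simp

text \<open>Registers below \<open>d\<close> hold the loop bound, as \<open>2 \<le> d\<close>, and
  the counters of enclosing loops.\<close>

lemma com_code_correct:
  assumes "code_at P pc (com_code pc d c)" "2 \<le> d" "d + com_depth c \<le> 2 ^ q"
    and "stores M s" "M 1 = N"
  shows "\<exists>M'. reaches P x (poly (com_time c) N) (pc, M) (pc + length (com_code pc d c), M') \<and>
    stores M' (run x N c s) \<and> (\<forall>a<d. M' a = M a)"
  using assms
proof (induction c arbitrary: pc d M s)
  case Skip
  have "reaches P x (poly (com_time Skip) N) (pc, M) (pc + length (com_code pc d Skip), M)"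
    by simp
  moreover have "stores M (run x N Skip s)"
    using Skip by simp
  ultimately show ?case
    by blast
next
  case (Assign v i e)
  let ?i = "expr_code d i" and ?a = "address_code d v" and ?e = "expr_code (Suc d) e"
  let ?pc1 = "pc + length ?i" let ?pc2 = "?pc1 + length ?a" let ?pc3 = "?pc2 + length ?e"
  have code: "code_at P pc ?i" "code_at P ?pc1 ?a" "code_at P ?pc2 ?e"
      "code_at P ?pc3 [Store d (Suc d)]"
    using Assign.prems(1) by (simp_all add: add.assoc)
  have depth: "d + expr_depth i \<le> 2 ^ q" "Suc d + expr_depth e \<le> 2 ^ q" "Suc d < 2 ^ q"
    using Assign.prems(3) by simp_all
  obtain M1 where 1: "reaches P x (length ?i) (pc, M) (?pc1, M1)"
    "M1 d = eval x s i" "\<forall>a. a < d \<or> 2 ^ q \<le> a \<longrightarrow> M1 a = M a"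
    using expr_code_correct[OF code(1) depth(1) Assign.prems(4)] by blast
  obtain M2 where 2: "reaches P x (length ?a) (?pc1, M1) (?pc2, M2)"
    "M2 d = address v (M1 d)" "\<And>a. a \<noteq> d \<Longrightarrow> a \<noteq> Suc d \<Longrightarrow> M2 a = M1 a"
    using address_code_correct[OF code(2)] by blast
  have st2: "stores M2 s"
    using 1(3) 2(3) depth(3) by (intro stores_cong[OF Assign.prems(4)]) auto
  obtain M3 where 3: "reaches P x (length ?e) (?pc2, M2) (?pc3, M3)"
    "M3 (Suc d) = eval x s e" "\<forall>a. a < Suc d \<or> 2 ^ q \<le> a \<longrightarrow> M3 a = M2 a"
    using expr_code_correct[OF code(3) depth(2) st2] by blast
  let ?M4 = "M3(M3 d := M3 (Suc d))"
  have 4: "reaches P x 1 (?pc3, M3) (Suc ?pc3, ?M4)"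
    using code(4) unfolding One_nat_def by (auto intro!: reaches_step)
  have M3d: "M3 d = address v (eval x s i)"
    using 1(2) 2(2) 3(3) by simp
  have "stores M3 s"
    using 3(3) by (intro stores_cong[OF st2]) simp
  then have "stores ?M4 (run x N (Assign v i e) s)"
    unfolding M3d 3(2) run.simps by (rule stores_upd)
  moreover have "\<forall>a<d. ?M4 a = M a"
    using 1(3) 2(3) 3(3) address_ge[of v "eval x s i"] depth(3) unfolding M3d by auto
  moreover have "reaches P x (poly (com_time (Assign v i e)) N) (pc, M)
      (pc + length (com_code pc d (Assign v i e)), ?M4)"
    using reaches_trans[OF reaches_trans[OF reaches_trans[OF 1(1) 2(1)] 3(1)] 4]
    by (simp add: add_ac length_expr_code[of 2 i d] length_expr_code[of 2 e "Suc d"]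
        length_address_code)
  ultimately show ?case
    by blast
next
  case (Seq c b)
  let ?c = "com_code pc d c" and ?b = "com_code (pc + length (com_code pc d c)) d b"
  have code: "code_at P pc ?c" "code_at P (pc + length ?c) ?b"
    and len: "length (com_code pc d (Seq c b)) = length ?c + length ?b"
    using Seq.prems(1) by (simp_all add: Let_def)
  have depth: "d + com_depth c \<le> 2 ^ q" "d + com_depth b \<le> 2 ^ q"
    using Seq.prems(3) by simp_all
  obtain M1 where 1: "reaches P x (poly (com_time c) N) (pc, M) (pc + length ?c, M1)"
    "stores M1 (run x N c s)" "\<forall>a<d. M1 a = M a"
    using Seq.IH(1)[OF code(1) Seq.prems(2) depth(1) Seq.prems(4,5)] by blast
  have N1: "M1 1 = N"
    using 1(3) Seq.prems(2,5) by simp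
  obtain M2 where 2: "reaches P x (poly (com_time b) N) (pc + length ?c, M1)
      (pc + length ?c + length ?b, M2)"
    "stores M2 (run x N b (run x N c s))" "\<forall>a<d. M2 a = M1 a"
    using Seq.IH(2)[OF code(2) Seq.prems(2) depth(2) 1(2) N1] by blast
  have "reaches P x (poly (com_time (Seq c b)) N) (pc, M)
      (pc + length (com_code pc d (Seq c b)), M2)"
    using reaches_trans[OF 1(1) 2(1)] unfolding len by (simp add: add.assoc)
  moreover have "stores M2 (run x N (Seq c b) s)" "\<forall>a<d. M2 a = M a"
    using 1(3) 2(2,3) by simp_all
  ultimately show ?case
    by blast
next
  case (Cond e c b)
  let ?e = "expr_code d e"
  let ?c = "com_code (pc + length ?e + 1) d c"
  let ?pc = "pc + length ?e + length ?c + 2"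
  let ?b = "com_code ?pc d b"
  let ?end = "pc + length (com_code pc d (Cond e c b))"
  have code: "code_at P pc ?e" "code_at P (pc + length ?e) [JumpZero d ?pc]"
    "code_at P (pc + length ?e + 1) ?c" "code_at P (pc + length ?e + 1 + length ?c) [Jump ?end]"
    "code_at P ?pc ?b" and end_eq: "?end = ?pc + length ?b"
    using Cond.prems(1) by (simp_all add: Let_def add_ac)
  have depth: "d + expr_depth e \<le> 2 ^ q" "d + com_depth c \<le> 2 ^ q" "d + com_depth b \<le> 2 ^ q"
    using Cond.prems(3) by simp_all
  obtain M1 where 1: "reaches P x (length ?e) (pc, M) (pc + length ?e, M1)"
    "M1 d = eval x s e" "\<forall>a. a < d \<or> 2 ^ q \<le> a \<longrightarrow> M1 a = M a"
    using expr_code_correct[OF code(1) depth(1) Cond.prems(4)] by blast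
  have st: "stores M1 s"
    using 1(3) by (intro stores_cong[OF Cond.prems(4)]) simp
  have N1: "M1 1 = N"
    using 1(3) Cond.prems(2,5) by simp
  have jz: "reaches P x 1 (pc + length ?e, M1)
      (if eval x s e = 0 then ?pc else pc + length ?e + 1, M1)"
    using code(2) 1(2) unfolding One_nat_def by (auto intro!: reaches_step)
  note upto = reaches_trans[OF 1(1) jz]
  show ?case
  proof (cases "eval x s e = 0")
    case True
    obtain M2 where 2: "reaches P x (poly (com_time b) N) (?pc, M1) (?pc + length ?b, M2)"
      "stores M2 (run x N b s)" "\<forall>a<d. M2 a = M1 a"
      using Cond.IH(2)[OF code(5) Cond.prems(2) depth(3) st N1] by blast
    have "reaches P x (poly (com_time (Cond e c b)) N) (pc, M) (?end, M2)"
      unfolding end_eq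
      by (rule reaches_mono[OF reaches_trans[OF upto[unfolded if_P[OF True]] 2(1)]])
        (simp add: length_expr_code[of 2 e d])
    moreover have "stores M2 (run x N (Cond e c b) s)" "\<forall>a<d. M2 a = M a"
      using True 1(3) 2(2,3) by simp_all
    ultimately show ?thesis
      by blast
  next
    case False
    obtain M2 where 2: "reaches P x (poly (com_time c) N) (pc + length ?e + 1, M1)
        (pc + length ?e + 1 + length ?c, M2)"
      "stores M2 (run x N c s)" "\<forall>a<d. M2 a = M1 a"
      using Cond.IH(1)[OF code(3) Cond.prems(2) depth(2) st N1] by blast
    have jmp: "reaches P x 1 (pc + length ?e + 1 + length ?c, M2) (?end, M2)"
      using code(4) unfolding One_nat_def by (auto intro!: reaches_step)
    have "reaches P x (poly (com_time (Cond e c b)) N) (pc, M) (?end, M2)"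
      by (rule reaches_mono[OF
            reaches_trans[OF reaches_trans[OF upto[unfolded if_not_P[OF False]] 2(1)] jmp]])
        (simp add: length_expr_code[of 2 e d])
    moreover have "stores M2 (run x N (Cond e c b) s)" "\<forall>a<d. M2 a = M a"
      using False 1(3) 2(2,3) by simp_all
    ultimately show ?thesis
      by blast
  qed
next
  case (For v c)
  let ?c = "com_code (pc + 5) (Suc d) c"
  let ?end = "pc + length ?c + 8"
  let ?T = "7 + poly (com_time c) N"
  let ?s = "\<lambda>k. rec_nat s (\<lambda>k s'. run x N c (upd s' v 0 k)) k"
  have code: "code_at P pc [Const d 0, Sub (Suc d) 1 d, JumpZero (Suc d) ?end,
      Const (Suc d) 0, Add (address v 0) d (Suc d)]" "code_at P (pc + 5) ?c"
      "code_at P (pc + 5 + length ?c) [Const (Suc d) 1, Add d d (Suc d), Jump (pc + 1)]"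
    using For.prems(1) by (simp_all add: Let_def eval_nat_numeral)
  have depth: "Suc (Suc d) \<le> 2 ^ q" "Suc d + com_depth c \<le> 2 ^ q" "2 \<le> Suc d"
    using For.prems(2,3) by simp_all
  \<comment> \<open>The state at the loop test, \<open>pc + 1\<close>, after \<open>k\<close>
    rounds; the final failing test is charged separately.\<close>
  have iter: "\<exists>M'. reaches P x (1 + k * ?T) (pc, M) (pc + 1, M') \<and> M' d = k \<and>
      stores M' (?s k) \<and> (\<forall>a<d. M' a = M a)" if "k \<le> N" for k
    using that
  proof (induction k)
    case 0
    have "reaches P x (1 + 0 * ?T) (pc, M) (pc + 1, M(d := 0))"
      using code(1) by (auto intro!: reaches_step)
    moreover have "stores (M(d := 0)) (?s 0)"
      using depth stores_cong[OF For.prems(4), of "M(d := 0)"] by auto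
    moreover have "(M(d := 0)) d = 0" "\<forall>a<d. (M(d := 0)) a = M a"
      by simp_all
    ultimately show ?case
      by blast
  next
    case (Suc k)
    then obtain M1 where 1: "reaches P x (1 + k * ?T) (pc, M) (pc + 1, M1)" "M1 d = k"
      "stores M1 (?s k)" "\<forall>a<d. M1 a = M a"
      using Suc_leD by blast
    have N1: "M1 1 = N"
      using 1(4) For.prems(2,5) by simp
    let ?M2 = "M1(Suc d := 0, address v 0 := k)"
    have v0: "address v 0 \<noteq> d" "address v 0 \<noteq> Suc d" "address v 0 \<noteq> 1"
      "\<And>a. a < d \<Longrightarrow> a \<noteq> address v 0"
      using address_ge[of v 0] depth by auto
    have 2: "reaches P x 4 (pc + 1, M1) (pc + 5, ?M2)"
      using code(1) N1 1(2) Suc.prems v0 depth(3)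
      by (auto intro!: reaches_step simp: eval_nat_numeral)
    have "stores (M1(Suc d := 0)) (?s k)"
      using depth by (intro stores_cong[OF 1(3)]) auto
    then have st2: "stores ?M2 (upd (?s k) v 0 k)"
      by (rule stores_upd)
    have N2: "?M2 1 = N"
      using N1 v0 depth For.prems(2) by auto
    obtain M3 where 3: "reaches P x (poly (com_time c) N) (pc + 5, ?M2)
        (pc + 5 + length ?c, M3)" "stores M3 (run x N c (upd (?s k) v 0 k))"
        "\<forall>a<Suc d. M3 a = ?M2 a"
      using For.IH[OF code(2) depth(3,2) st2 N2] by blast
    let ?M4 = "M3(Suc d := 1, d := Suc k)"
    have M3d: "M3 d = k"
      using 3(3) 1(2) v0 by simp
    have 4: "reaches P x 3 (pc + 5 + length ?c, M3) (pc + 1, ?M4)"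
      using code(3) M3d by (auto intro!: reaches_step simp: eval_nat_numeral)
    have "reaches P x (1 + Suc k * ?T) (pc, M) (pc + 1, ?M4)"
      by (rule reaches_mono[OF reaches_trans[OF reaches_trans[OF reaches_trans[OF 1(1) 2] 3(1)] 4]])
        simp
    moreover have "stores ?M4 (?s (Suc k))"
      using depth stores_cong[OF 3(2), of ?M4] by simp
    moreover have "?M4 d = Suc k" "\<forall>a<d. ?M4 a = M a"
      using 1(4) 3(3) v0 by auto
    ultimately show ?case
      by blast
  qed
  then obtain M1 where 1: "reaches P x (1 + N * ?T) (pc, M) (pc + 1, M1)" "M1 d = N"
    "stores M1 (?s N)" "\<forall>a<d. M1 a = M a"
    by blast
  have N1: "M1 1 = N"
    using 1(4) For.prems(2,5) by simp
  \<comment> \<open>The last test leaves the difference \<open>N - N\<close> in register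
    \<open>Suc d\<close>.\<close>
  let ?M2 = "M1(Suc d := 0)"
  have 2: "reaches P x 2 (pc + 1, M1) (?end, ?M2)"
    using code(1) N1 1(2) unfolding numeral_2_eq_2 by (auto intro!: reaches_step)
  have "stores ?M2 (run x N (For v c) s)"
    using depth stores_cong[OF 1(3), of ?M2] by simp
  moreover have "reaches P x (poly (com_time (For v c)) N) (pc, M)
      (pc + length (com_code pc d (For v c)), ?M2)"
  proof -
    have end_eq: "pc + length (com_code pc d (For v c)) = ?end"
      by (simp add: Let_def)
    show ?thesis
      unfolding end_eq by (rule reaches_mono[OF reaches_trans[OF 1(1) 2]]) simp
  qed
  moreover have "\<forall>a<d. ?M2 a = M a"
    using 1(4) by simp
  ultimately show ?case
    by blast
qed

text \<open>Evaluating \<open>e\<close> at depth 1 puts its value into register 1, the place of the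
  loop bound.\<close>

definition phase_code :: "nat \<Rightarrow> 'v expr \<Rightarrow> 'v com \<Rightarrow> instr list" where
  "phase_code pc e c = expr_code 1 e @ com_code (pc + length (expr_code 1 e)) 2 c"

lemma phase_code_correct:
  assumes code: "code_at P pc (phase_code pc e c)" and st: "stores M s"
    and depth: "1 + expr_depth e \<le> 2 ^ q" "2 + com_depth c \<le> 2 ^ q"
  shows "\<exists>M'. reaches P x (length (expr_code 1 e) + poly (com_time c) (eval x s e))
    (pc, M) (pc + length (phase_code pc e c), M') \<and> stores M' (run x (eval x s e) c s)"
proof -
  let ?e = "expr_code 1 e" and ?c = "com_code (pc + length (expr_code 1 e)) 2 c"
  have c: "code_at P pc ?e" "code_at P (pc + length ?e) ?c"
    using code by (simp_all add: phase_code_def)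
  obtain M1 where 1: "reaches P x (length ?e) (pc, M) (pc + length ?e, M1)"
    "M1 1 = eval x s e" "\<forall>a. a < 1 \<or> 2 ^ q \<le> a \<longrightarrow> M1 a = M a"
    using expr_code_correct[OF c(1) depth(1) st] by blast
  have st1: "stores M1 s"
    using 1(3) by (intro stores_cong[OF st]) simp
  obtain M2 where 2: "reaches P x (poly (com_time c) (eval x s e)) (pc + length ?e, M1)
      (pc + length ?e + length ?c, M2)" "stores M2 (run x (eval x s e) c s)"
    using com_code_correct[OF c(2) order.refl depth(2) st1 1(2)] by blast
  have "pc + length ?e + length ?c = pc + length (phase_code pc e c)"
    by (simp add: phase_code_def)
  then show ?thesis
    using reaches_trans[OF 1(1) 2(1)] 2(2) by (metis (no_types))
qed

text \<open>The second bound is evaluated in the store left by the first phase. The result is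
  evaluated at depth 0, because the machine answers in register 0.\<close>

definition two_phase_code :: "'v expr \<Rightarrow> 'v com \<Rightarrow> 'v expr \<Rightarrow> 'v com \<Rightarrow> 'v expr \<Rightarrow> instr list" where
  "two_phase_code e c e' c' r =
     (let p = phase_code 0 e c in p @ phase_code (length p) e' c' @ expr_code 0 r)"

definition two_phase_time :: "'v expr \<Rightarrow> 'v com \<Rightarrow> 'v expr \<Rightarrow> 'v com \<Rightarrow> 'v expr \<Rightarrow> nat poly" where
  "two_phase_time e c e' c' r =
     [:length (expr_code 1 e) + length (expr_code 1 e') + length (expr_code 0 r):] +
     com_time c + com_time c'"

lemma two_phase_code_correct:
  fixes s0 :: "'v store"
  assumes s0: "s0 = (\<lambda>_ _. 0)"
    and s1: "s1 = run x (eval x s0 e) c s0" and s2: "s2 = run x (eval x s1 e') c' s1"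
    and bound: "eval x s0 e \<le> B" "eval x s1 e' \<le> B"
    and depth: "1 + expr_depth e \<le> 2 ^ q" "2 + com_depth c \<le> 2 ^ q"
      "1 + expr_depth e' \<le> 2 ^ q" "2 + com_depth c' \<le> 2 ^ q" "expr_depth r \<le> 2 ^ q"
  shows "halts_within (two_phase_code e c e' c' r) x (poly (two_phase_time e c e' c' r) B)
    (eval x s2 r)"
proof -
  let ?P = "two_phase_code e c e' c' r"
  let ?p = "phase_code 0 e c"
  let ?p' = "phase_code (length ?p) e' c'"
  let ?r = "expr_code 0 r"
  have P: "?P = [] @ ?p @ (?p' @ ?r)" "?P = ?p @ ?p' @ ?r" "?P = (?p @ ?p') @ ?r @ []"
    by (simp_all add: two_phase_code_def Let_def)
  have code: "code_at ?P 0 ?p" "code_at ?P (length ?p) ?p'" "code_at ?P (length ?p + length ?p') ?r"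
    using code_at_middle[of "[]" ?p "?p' @ ?r", folded P(1)] code_at_middle[of ?p ?p' ?r, folded P(2)]
      code_at_middle[of "?p @ ?p'" ?r "[]", folded P(3)] by simp_all
  have st: "stores (\<lambda>_. 0) s0"
    by (simp add: stores_def s0)
  obtain M1 where 1: "reaches ?P x (length (expr_code 1 e) + poly (com_time c) (eval x s0 e))
      (0, \<lambda>_. 0) (length ?p, M1)" "stores M1 s1"
    using phase_code_correct[OF code(1) st depth(1,2)] unfolding s1 by auto
  obtain M2 where 2: "reaches ?P x (length (expr_code 1 e') + poly (com_time c') (eval x s1 e'))
      (length ?p, M1) (length ?p + length ?p', M2)" "stores M2 s2"
    using phase_code_correct[OF code(2) 1(2) depth(3,4)] unfolding s2 by blast
  have "0 + expr_depth r \<le> 2 ^ q"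
    using depth(5) by simp
  then obtain M3 where 3: "reaches ?P x (length ?r) (length ?p + length ?p', M2)
      (length ?p + length ?p' + length ?r, M3)" "M3 0 = eval x s2 r"
    using expr_code_correct[OF code(3) _ 2(2)] by blast
  have end_eq: "length ?p + length ?p' + length ?r = length ?P"
    by (simp add: P(2))
  \<comment> \<open>Natural coefficients make polynomials monotone, so both phases can be charged at
    the common bound \<open>B\<close>.\<close>
  have mono: "poly p a \<le> poly p b" if "a \<le> b" for p :: "nat poly" and a b
    using that by (induction p) (auto intro!: add_mono mult_mono)
  have "reaches ?P x (poly (two_phase_time e c e' c' r) B) (0, \<lambda>_. 0) (length ?P, M3)"
    using mono[OF bound(1), of "com_time c"] mono[OF bound(2), of "com_time c'"]
    by (intro reaches_mono[OF reaches_trans[OF reaches_trans[OF 1(1) 2(1)] 3(1)[unfolded end_eq]]])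
      (simp add: two_phase_time_def)
  then obtain k where k: "k \<le> poly (two_phase_time e c e' c' r) B"
    "(ram_step ?P x ^^ k) (0, \<lambda>_. 0) = (length ?P, M3)"
    by (auto simp: reaches_def)
  \<comment> \<open>\<open>halts_within\<close> looks at one exact step count; a halted state is a
    fixed point, so arriving earlier is enough.\<close>
  have halted: "(ram_step ?P x ^^ j) (length ?P, M3) = (length ?P, M3)" for j
    by (induction j) (simp_all add: ram_step_def)
  have "(ram_step ?P x ^^ poly (two_phase_time e c e' c' r) B) (0, \<lambda>_. 0) = (length ?P, M3)"
  proof -
    have "ram_step ?P x ^^ poly (two_phase_time e c e' c' r) B =
        (ram_step ?P x ^^ (poly (two_phase_time e c e' c' r) B - k)) \<circ> (ram_step ?P x ^^ k)"
      using k(1) by (simp flip: funpow_add)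
    then show ?thesis
      using k(2) halted by simp
  qed
  then show ?thesis
    using 3(2) by (simp add: halts_within_def)
qed

end

section \<open>The program\<close>

datatype side = First | Second

datatype var =
    Order side | Base side | Row side | Dead side | Node side | Leaves side
  | Join side | LChild side | RChild side | TRow | Table
  | IdxU | IdxV | IdxW | Step | Good | TwinU | TwinV | Acc | Result

abbreviation scalar :: "var \<Rightarrow> var expr" where
  "scalar v \<equiv> Cell v (Num 0)"

abbreviation set_scalar :: "var \<Rightarrow> var expr \<Rightarrow> var com" where
  "set_scalar v e \<equiv> Assign v (Num 0) e"

abbreviation When :: "var expr \<Rightarrow> var com \<Rightarrow> var com" where
  "When e c \<equiv> Cond e c Skip"

text \<open>Nonzero values count as true; the truncated difference \<open>a - (a - b)\<close> is the minimum of \<open>a\<close>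
  and \<open>b\<close>.\<close>

definition Less :: "var expr \<Rightarrow> var expr \<Rightarrow> var expr" where
  "Less a b = Minus b a"

definition Differ :: "var expr \<Rightarrow> var expr \<Rightarrow> var expr" where
  "Differ a b = Plus (Minus a b) (Minus b a)"

definition Both :: "var expr \<Rightarrow> var expr \<Rightarrow> var expr" where
  "Both a b = Minus a (Minus a b)"

definition Neg :: "var expr \<Rightarrow> var expr" where
  "Neg a = Minus (Num 1) a"

definition Maximum :: "var expr \<Rightarrow> var expr \<Rightarrow> var expr" where
  "Maximum a b = Plus a (Minus b a)"

lemma eval_Less [simp]: "0 < eval x s (Less a b) \<longleftrightarrow> eval x s a < eval x s b"
  by (simp add: Less_def)

lemma eval_Differ [simp]: "0 < eval x s (Differ a b) \<longleftrightarrow> eval x s a \<noteq> eval x s b"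
  by (auto simp: Differ_def)

lemma eval_Both [simp]: "0 < eval x s (Both a b) \<longleftrightarrow> 0 < eval x s a \<and> 0 < eval x s b"
  by (auto simp: Both_def)

lemma eval_Neg [simp]: "0 < eval x s (Neg a) \<longleftrightarrow> eval x s a = 0"
  by (auto simp: Neg_def)

lemma eval_Maximum [simp]: "eval x s (Maximum a b) = max (eval x s a) (eval x s b)"
  by (simp add: Maximum_def max_def)

text \<open>\<open>Row g\<close> holds the input position at which each matrix row starts, base
  offset included.\<close>

definition adjacent :: "side \<Rightarrow> var expr \<Rightarrow> var expr \<Rightarrow> var expr" where
  "adjacent g a b = Input (Plus (Cell (Row g) a) b)"

lemma eval_adjacent [simp]:
  "eval x s (adjacent g a b) = input_at x (s (Row g) (eval x s a) + eval x s b)"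
  by (simp add: adjacent_def)

text \<open>Replaces multiplication: running sums yield all row offsets at once.\<close>

definition multiples :: "var \<Rightarrow> var expr \<Rightarrow> var expr \<Rightarrow> var com" where
  "multiples v e d =
     Seq (set_scalar Acc e)
         (For IdxU (Seq (Assign v (scalar IdxU) (scalar Acc))
                        (set_scalar Acc (Plus (scalar Acc) d))))"

definition leaves :: "side \<Rightarrow> var com" where
  "leaves g = For IdxU (Seq (Assign (Node g) (scalar IdxU) (scalar IdxU))
                            (Assign (Leaves g) (scalar IdxU) (Num 1)))"

text \<open>True if \<open>IdxW\<close> refutes twinship. All conjuncts are evaluated even when the
  range test fails; \<open>Both\<close>, a minimum, masks the junk.\<close>

definition separates :: "side \<Rightarrow> var expr" where
  "separates g =
     Both (Both (Less (scalar IdxW) (scalar (Order g))) (Neg (Cell (Dead g) (scalar IdxW))))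
          (Both (Both (Differ (scalar IdxW) (scalar IdxU)) (Differ (scalar IdxW) (scalar IdxV)))
                (Differ (adjacent g (scalar IdxU) (scalar IdxW))
                        (adjacent g (scalar IdxV) (scalar IdxW))))"

definition candidates :: "side \<Rightarrow> var expr" where
  "candidates g =
     Both (Both (Both (Less (scalar IdxU) (scalar (Order g))) (Less (scalar IdxV) (scalar (Order g))))
                (Differ (scalar IdxU) (scalar IdxV)))
          (Both (Neg (Cell (Dead g) (scalar IdxU))) (Neg (Cell (Dead g) (scalar IdxV))))"

definition test_twins :: "side \<Rightarrow> var com" where
  "test_twins g =
     Seq (set_scalar Good (Num 1)) (For IdxW (When (separates g) (set_scalar Good (Num 0))))"

definition try_pair :: "side \<Rightarrow> var com" where
  "try_pair g =
     When (candidates g)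
       (Seq (test_twins g)
            (When (scalar Good)
               (Seq (set_scalar TwinU (scalar IdxU)) (set_scalar TwinV (scalar IdxV)))))"

text \<open>There is no early exit: a later pair of twins overwrites an earlier one, and any pair
  will do.\<close>

definition find_twins :: "side \<Rightarrow> var com" where
  "find_twins g = For IdxU (For IdxV (try_pair g))"

text \<open>The node of \<open>TwinU\<close> is replaced only after \<open>u\<close> and
  \<open>v\<close> have been used. \<open>TwinU\<close> stays as representative,
  \<open>TwinV\<close> dies.\<close>

definition merge_twins :: "side \<Rightarrow> var com" where
  "merge_twins g =
     (let a = Plus (scalar (Order g)) (scalar Step);
          u = Cell (Node g) (scalar TwinU);
          v = Cell (Node g) (scalar TwinV)
      in Seq (Seq (Assign (Join g) a (adjacent g (scalar TwinU) (scalar TwinV)))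
                  (Seq (Assign (LChild g) a u) (Assign (RChild g) a v)))
             (Seq (Assign (Leaves g) a (Plus (Cell (Leaves g) u) (Cell (Leaves g) v)))
                  (Seq (Assign (Node g) (scalar TwinU) a) (Assign (Dead g) (scalar TwinV) (Num 1)))))"

text \<open>The guard ends the merging when one representative is left; the remaining rounds are
  idle.\<close>

definition decompose :: "side \<Rightarrow> var com" where
  "decompose g =
     For Step (When (Less (Plus (scalar Step) (Num 1)) (scalar (Order g)))
       (Seq (find_twins g) (merge_twins g)))"

definition prepare :: "side \<Rightarrow> var com" where
  "prepare g =
     Seq (multiples (Row g) (scalar (Base g)) (scalar (Order g))) (Seq (leaves g) (decompose g))"

definition table :: "var expr \<Rightarrow> var expr \<Rightarrow> var expr" where
  "table a b = Cell Table (Plus (Cell TRow a) b)"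

lemma eval_table [simp]:
  "eval x s (table a b) = s Table (s TRow (eval x s a) + eval x s b)"
  by (simp add: table_def)

text \<open>The cases come in the order of \<open>prod_alpha_cotree\<close>, so the two can be
  compared branch by branch.\<close>

definition fill_entry :: "var com" where
  "fill_entry =
     (let a = scalar IdxU; b = scalar IdxV;
          put = Assign Table (Plus (Cell TRow a) b);
          la = table (Cell (LChild First) a) b; ra = table (Cell (RChild First) a) b;
          lb = table a (Cell (LChild Second) b); rb = table a (Cell (RChild Second) b)
      in Cond (Less a (scalar (Order First))) (put (Cell (Leaves Second) b))
         (Cond (Less b (scalar (Order Second))) (put (Cell (Leaves First) a))
         (Cond (Neg (Cell (Join First) a)) (put (Plus la ra))
         (Cond (Neg (Cell (Join Second) b)) (put (Plus lb rb))
         (put (Maximum (Maximum la ra) (Maximum lb rb)))))))"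

text \<open>Children have smaller numbers, so the sweep finds its operands ready. Pairs beyond the
  real nodes get junk in cells of their own.\<close>

definition fill_table :: "var com" where
  "fill_table = For IdxU (For IdxV fill_entry)"

text \<open>Serves both as loop bound of the second phase and as stride of the table, so that every
  column index stays below the stride.\<close>

definition width :: "var expr \<Rightarrow> var expr \<Rightarrow> var expr" where
  "width a b = Plus (Plus a a) (Plus b b)"

text \<open>Run with loop bound \<open>n\<close>, this squares \<open>n\<close> by adding it
  \<open>n\<close> times.\<close>

definition phase1 :: "var com" where
  "phase1 = For IdxU (set_scalar Acc (Plus (scalar Acc) (Input (Num 0))))"

definition header :: "var com" where
  "header =
     Seq (Seq (set_scalar (Order First) (Input (Num 0)))
              (set_scalar (Order Second) (Input (Plus (Num 1) (scalar Acc)))))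
         (Seq (set_scalar (Base First) (Num 1))
              (set_scalar (Base Second) (Plus (Num 2) (scalar Acc))))"

text \<open>An empty factor has no root; \<open>Result\<close> then keeps its initial 0, the correct
  value.\<close>

definition report :: "var com" where
  "report =
     When (Both (scalar (Order First)) (scalar (Order Second)))
       (set_scalar Result
          (table (Minus (Plus (scalar (Order First)) (scalar (Order First))) (Num 2))
                 (Minus (Plus (scalar (Order Second)) (scalar (Order Second))) (Num 2))))"

definition phase2 :: "var com" where
  "phase2 =
     Seq header (Seq (Seq (prepare First) (prepare Second))
       (Seq (multiples TRow (Num 0) (width (scalar (Order First)) (scalar (Order Second))))
            (Seq fill_table report)))"

section \<open>Correctness of the program\<close>

text \<open>The increment \<open>d\<close> is evaluated anew in each round, so it must be
  insensitive to the variables that the loop writes.\<close>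

lemma run_multiples:
  assumes "v \<noteq> Acc" "v \<noteq> IdxU" "i < N"
    and d: "\<And>s'. \<forall>w. w \<notin> {v, Acc, IdxU} \<longrightarrow> s' w = s w \<Longrightarrow> eval x s' d = k"
  shows "run x N (multiples v e d) s v i = eval x s e + i * k"
proof -
  let ?b = "eval x s e"
  let ?I = "\<lambda>j t. t Acc 0 = ?b + j * k \<and> (\<forall>i<j. t v i = ?b + i * k) \<and>
    (\<forall>w. w \<notin> {v, Acc, IdxU} \<longrightarrow> t w = s w)"
  have "?I N (run x N (multiples v e d) s)"
    unfolding multiples_def run.simps(3)
  proof (rule run_For_invariant[where I = ?I])
    fix j t assume I: "?I j t"
    let ?t = "upd (upd t IdxU 0 j) v j (t Acc 0)"
    have "eval x ?t d = k"
      using I assms(1,2) by (intro d) (simp add: upd_def)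
    moreover have "run x N (Assign v (scalar IdxU) (scalar Acc)) (upd t IdxU 0 j) = ?t"
      by (simp add: upd_def)
    ultimately show "?I (Suc j) (run x N (Seq (Assign v (scalar IdxU) (scalar Acc))
        (set_scalar Acc (Plus (scalar Acc) d))) (upd t IdxU 0 j))"
      using I assms(1,2) by (auto simp: upd_def less_Suc_eq)
  qed (auto simp: upd_def)
  then show ?thesis
    using assms(3) by blast
qed

lemma run_leaves:
  assumes "i < N"
  shows "run x N (leaves g) s (Node g) i = i" "run x N (leaves g) s (Leaves g) i = 1"
proof -
  let ?I = "\<lambda>j t. \<forall>i<j. t (Node g) i = i \<and> t (Leaves g) i = 1"
  have "?I N (run x N (leaves g) s)"
    unfolding leaves_def
    by (rule run_For_invariant[where I = ?I]) (auto simp: upd_def less_Suc_eq)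
  then show "run x N (leaves g) s (Node g) i = i" "run x N (leaves g) s (Leaves g) i = 1"
    using assms by blast+
qed

section \<open>Verification of the twin search\<close>

definition alive :: "side \<Rightarrow> var store \<Rightarrow> nat set" where
  "alive g s = {v. v < s (Order g) 0 \<and> s (Dead g) v = 0}"

definition reads_graph :: "nat list \<Rightarrow> side \<Rightarrow> var store \<Rightarrow> (nat \<Rightarrow> nat \<Rightarrow> bool) \<Rightarrow> bool" where
  "reads_graph x g s E \<longleftrightarrow> (\<forall>i < s (Order g) 0. \<forall>j < s (Order g) 0.
     input_at x (s (Row g) i + j) = of_bool (E i j))"

lemma run_test_twins:
  assumes N: "s (Order g) 0 \<le> N" and E: "reads_graph x g s E"
    and uv: "s IdxU 0 < s (Order g) 0" "s IdxV 0 < s (Order g) 0"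
  shows "0 < run x N (test_twins g) s Good 0 \<longleftrightarrow>
    (\<forall>w\<in>alive g s. w \<noteq> s IdxU 0 \<longrightarrow> w \<noteq> s IdxV 0 \<longrightarrow> E (s IdxU 0) w = E (s IdxV 0) w)"
proof -
  let ?ok = "\<lambda>w. w \<in> alive g s \<longrightarrow> w \<noteq> s IdxU 0 \<longrightarrow> w \<noteq> s IdxV 0 \<longrightarrow>
    E (s IdxU 0) w = E (s IdxV 0) w"
  let ?I = "\<lambda>j t. (\<forall>y. y \<notin> {Good, IdxW} \<longrightarrow> t y = s y) \<and>
    (0 < t Good 0 \<longleftrightarrow> (\<forall>w<j. ?ok w))"
  have "?I N (run x N (test_twins g) s)"
    unfolding test_twins_def run.simps(3)
  proof (rule run_For_invariant[where I = ?I])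
    fix j t assume I: "?I j t"
    let ?t = "upd t IdxW 0 j"
    have "0 < eval x ?t (separates g) \<longleftrightarrow> \<not> ?ok j"
      using I uv E by (auto simp: separates_def upd_def alive_def reads_graph_def)
    then show "?I (Suc j) (run x N (When (separates g) (set_scalar Good (Num 0))) ?t)"
      using I by (auto simp: upd_def less_Suc_eq)
  qed (auto simp: upd_def)
  \<comment> \<open>Surviving vertices lie below the order and hence below \<open>N\<close>, so the
    loop has met all of them.\<close>
  moreover have "(\<forall>w<N. ?ok w) \<longleftrightarrow> (\<forall>w. ?ok w)"
    using N by (auto simp: alive_def)
  ultimately show ?thesis
    by blast
qed

lemma run_try_pair:
  assumes N: "s (Order g) 0 \<le> N" and E: "reads_graph x g s E"
  shows "run x N (try_pair g) s TwinU 0 =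
      (if twins (alive g s) E (s IdxU 0) (s IdxV 0) then s IdxU 0 else s TwinU 0)"
    and "run x N (try_pair g) s TwinV 0 =
      (if twins (alive g s) E (s IdxU 0) (s IdxV 0) then s IdxV 0 else s TwinV 0)"
proof -
  let ?u = "s IdxU 0" and ?v = "s IdxV 0" and ?n = "s (Order g) 0"
  let ?t = "run x N (test_twins g) s"
  have t: "?t y = s y" if "y \<in> {TwinU, TwinV, IdxU, IdxV}" for y
    using that by (intro run_not_written) (auto simp: test_twins_def)
  have c: "0 < eval x s (candidates g) \<longleftrightarrow> ?u \<in> alive g s \<and> ?v \<in> alive g s \<and> ?u \<noteq> ?v"
    by (auto simp: candidates_def alive_def)
  have good: "0 < ?t Good 0 \<longleftrightarrow> twins (alive g s) E ?u ?v" if "0 < eval x s (candidates g)"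
    using run_test_twins[OF N E] that unfolding c by (simp add: twins_def alive_def)
  have no: "\<not> twins (alive g s) E ?u ?v" if "\<not> 0 < eval x s (candidates g)"
    using that unfolding c by (auto simp: twins_def)
  show "run x N (try_pair g) s TwinU 0 =
      (if twins (alive g s) E (s IdxU 0) (s IdxV 0) then s IdxU 0 else s TwinU 0)"
    and "run x N (try_pair g) s TwinV 0 =
      (if twins (alive g s) E (s IdxU 0) (s IdxV 0) then s IdxV 0 else s TwinV 0)"
    using good no by (auto simp: try_pair_def t upd_def)
qed

lemma written_try_pair:
  "written (try_pair g) = {Good, IdxW, TwinU, TwinV}"
  by (auto simp: try_pair_def test_twins_def)

lemma run_find_twins:
  assumes N: "s (Order g) 0 \<le> N" and E: "reads_graph x g s E"
    and ex: "\<exists>u v. twins (alive g s) E u v"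
  shows "twins (alive g s) E (run x N (find_twins g) s TwinU 0) (run x N (find_twins g) s TwinV 0)"
proof -
  let ?T = "twins (alive g s) E"
  let ?F = "\<lambda>t. \<forall>y. y \<notin> {IdxU, IdxV, IdxW, Good, TwinU, TwinV} \<longrightarrow> t y = s y"
  \<comment> \<open>Both invariants are conditional: if twins occur among the pairs scanned so far,
    the stored pair is one. Existence enters only at the end.\<close>
  let ?I = "\<lambda>j t. ?F t \<and> ((\<exists>u<j. \<exists>v. ?T u v) \<longrightarrow> ?T (t TwinU 0) (t TwinV 0))"
  let ?J = "\<lambda>j i t. ?F t \<and> t IdxU 0 = j \<and>
    ((\<exists>u v. (u < j \<or> u = j \<and> v < i) \<and> ?T u v) \<longrightarrow> ?T (t TwinU 0) (t TwinV 0))"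
  have bounded: "u < N \<and> v < N" if "?T u v" for u v
    using that N by (auto simp: twins_def alive_def)
  have "?I N (run x N (find_twins g) s)"
    unfolding find_twins_def
  proof (rule run_For_invariant[where I = ?I])
    fix j t assume j: "j < N" and I: "?I j t"
    have "?J j N (run x N (For IdxV (try_pair g)) (upd t IdxU 0 j))"
    proof (rule run_For_invariant[where I = "?J j"])
      show "?J j 0 (upd t IdxU 0 j)"
        using I by (auto simp: upd_def)
    next
      fix i t assume J: "?J j i t"
      let ?t = "upd t IdxV 0 i"
      let ?t' = "run x N (try_pair g) ?t"
      have F: "?F ?t" and U: "?t IdxU 0 = j" "?t IdxV 0 = i"
        and tw: "?t TwinU = t TwinU" "?t TwinV = t TwinV"
        using J by (simp_all add: upd_def)
      have "alive g ?t = alive g s" "reads_graph x g ?t E" "?t (Order g) 0 \<le> N"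
        using F N E by (simp_all add: alive_def reads_graph_def)
      then have new: "?t' TwinU 0 = (if ?T j i then j else t TwinU 0)"
        "?t' TwinV 0 = (if ?T j i then i else t TwinV 0)"
        using run_try_pair[of ?t g N x E] U tw by simp_all
      have fr: "?t' y = ?t y" if "y \<notin> {Good, IdxW, TwinU, TwinV}" for y
        using that by (intro run_not_written) (simp add: written_try_pair)
      have "?F ?t'" "?t' IdxU 0 = j"
        using F U fr by auto
      moreover have "?T (?t' TwinU 0) (?t' TwinV 0)"
        if "\<exists>u v. (u < j \<or> u = j \<and> v < Suc i) \<and> ?T u v"
        using that J unfolding new by (auto simp: less_Suc_eq)
      ultimately show "?J j (Suc i) ?t'"
        by blast
    qed
    moreover have "\<exists>u v. (u < j \<or> u = j \<and> v < N) \<and> ?T u v" if "\<exists>u<Suc j. \<exists>v. ?T u v"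
      using that bounded by (metis less_SucE)
    ultimately show "?I (Suc j) (run x N (For IdxV (try_pair g)) (upd t IdxU 0 j))"
      by blast
  qed auto
  then show ?thesis
    using ex bounded by blast
qed

lemma written_find_twins:
  "written (find_twins g) = {IdxU, IdxV, IdxW, Good, TwinU, TwinV}"
  by (auto simp: find_twins_def written_try_pair)

lemma run_merge_twins:
  fixes s :: "var store" and g :: side and x :: "nat list" and N :: nat
  defines "a \<equiv> s (Order g) 0 + s Step 0"
    and "u \<equiv> s (Node g) (s TwinU 0)" and "v \<equiv> s (Node g) (s TwinV 0)"
    and "t \<equiv> run x N (merge_twins g) s"
  assumes "s TwinU 0 \<noteq> s TwinV 0"
  shows "t (Join g) = (s (Join g))(a := input_at x (s (Row g) (s TwinU 0) + s TwinV 0))"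
    "t (LChild g) = (s (LChild g))(a := u)"
    "t (RChild g) = (s (RChild g))(a := v)"
    "t (Leaves g) = (s (Leaves g))(a := s (Leaves g) u + s (Leaves g) v)"
    "t (Node g) = (s (Node g))(s TwinU 0 := a)"
    "t (Dead g) = (s (Dead g))(s TwinV 0 := 1)"
  unfolding t_def merge_twins_def a_def u_def v_def
  by (simp_all add: Let_def upd_def)

lemma written_merge_twins:
  "written (merge_twins g) = {Join g, LChild g, RChild g, Leaves g, Node g, Dead g}"
  by (auto simp: merge_twins_def Let_def)

section \<open>Verification of the cotree construction\<close>

definition has_cotree :: "side \<Rightarrow> var store \<Rightarrow> (nat \<Rightarrow> nat \<Rightarrow> bool) \<Rightarrow> nat \<Rightarrow> (nat \<Rightarrow> nat set) \<Rightarrow> bool" where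
  "has_cotree g s E k S \<longleftrightarrow>
     cotree (s (Order g) 0) E S (s (LChild g)) (s (RChild g)) (s (Join g)) (s (Leaves g)) k"

lemma run_decompose:
  assumes N: "n \<le> N" and n: "s (Order g) 0 = n" "0 < n"
    and E: "reads_graph x g s E" "symp E" "P4_free_on {..<n} E"
    and init: "\<And>i. i < n \<Longrightarrow> s (Node g) i = i" "\<And>i. i < n \<Longrightarrow> s (Leaves g) i = 1"
      "\<And>i. s (Dead g) i = 0"
  shows "\<exists>S. has_cotree g (run x N (decompose g) s) E (n - 1) S \<and> S (2 * n - 2) = {..<n}"
proof -
  let ?F = "\<lambda>t. t (Order g) = s (Order g) \<and> t (Row g) = s (Row g)"
  \<comment> \<open>\<open>min j (n - 1)\<close> is the number of merges done in \<open>j\<close>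
    rounds, idle ones included.\<close>
  let ?I = "\<lambda>j t. ?F t \<and> (\<exists>S. has_cotree g t E (min j (n - 1)) S \<and>
    twin_classes n E (alive g t) S (t (Node g)) (min j (n - 1)))"
  have "?I N (run x N (decompose g) s)"
    unfolding decompose_def
  proof (rule run_For_invariant[where I = ?I])
    have "alive g s = {..<n}"
      using n init(3) by (auto simp: alive_def)
    moreover have "has_cotree g s E 0 (\<lambda>a. {a})"
      using init(2) n by (simp add: has_cotree_def cotree_def)
    moreover have "twin_classes n E {..<n} (\<lambda>a. {a}) (s (Node g)) 0"
      using n(2) init(1) by (auto simp: twin_classes_def)
    ultimately show "?I 0 s"
      by auto
  next
    fix j t assume I: "?I j t"
    let ?c = "Seq (find_twins g) (merge_twins g)"
    let ?t = "upd t Step 0 j"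
    have F: "?F ?t" and tn: "?t (Order g) 0 = n"
      using I n by (simp_all add: upd_def)
    have same: "?t y = t y" if "y \<noteq> Step" for y
      using that by (simp add: upd_def)
    obtain S where S: "has_cotree g t E (min j (n - 1)) S"
      "twin_classes n E (alive g t) S (t (Node g)) (min j (n - 1))"
      using I by blast
    show "?I (Suc j) (run x N (When (Less (Plus (scalar Step) (Num 1)) (scalar (Order g))) ?c) ?t)"
    proof (cases "Suc j < n")
      case False
      then have "min (Suc j) (n - 1) = min j (n - 1)"
        by simp
      then show ?thesis
        using False tn F S same by (auto simp: upd_def has_cotree_def alive_def)
    next
      case True
      let ?f = "run x N (find_twins g) ?t"
      let ?m = "run x N (merge_twins g) ?f"
      have f: "?f y = ?t y" if "y \<notin> {IdxU, IdxV, IdxW, Good, TwinU, TwinV}" for y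
        using that by (intro run_not_written) (simp add: written_find_twins)
      have m: "?m y = ?f y" if "y \<notin> {Join g, LChild g, RChild g, Leaves g, Node g, Dead g}" for y
        using that by (intro run_not_written) (simp add: written_merge_twins)
      let ?L = "alive g t" and ?u = "?f TwinU 0" and ?v = "?f TwinV 0"
      have j: "min j (n - 1) = j" "min (Suc j) (n - 1) = Suc j"
        using True by simp_all
      have L: "?L \<subseteq> {..<n}" "card ?L + j = n"
        using S(2) unfolding j twin_classes_def by simp_all
      have al: "alive g ?t = ?L" and rd: "reads_graph x g ?t E"
        using F E(1) by (simp_all add: alive_def reads_graph_def upd_def)
      \<comment> \<open>In an active round \<open>n - j\<close> vertices survive, at least two, and
        they induce a P4-free graph.\<close>
      have "\<exists>u v. twins ?L E u v"
        using L True E(2) P4_free_on_subset[OF E(3) L(1)] finite_subset[OF L(1)]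
        by (intro P4_free_twins) auto
      then have tw: "twins ?L E ?u ?v"
        using run_find_twins[of ?t g N x E] rd N tn al by simp
      then have uv: "?u \<in> ?L" "?v \<in> ?L" "?u \<noteq> ?v"
        by (simp_all add: twins_def)
      then have lt: "?u < n" "?v < n"
        using L(1) by auto
      have fs: "?f (Order g) 0 = n" "?f Step 0 = j" "?f (Node g) = t (Node g)" "?f (Leaves g) = t (Leaves g)"
        "?f (Join g) = t (Join g)" "?f (LChild g) = t (LChild g)" "?f (RChild g) = t (RChild g)"
        "?f (Dead g) = t (Dead g)" "?f (Row g) = s (Row g)" "?f (Order g) = s (Order g)"
        using f tn F by (simp_all add: upd_def)
      have adj: "input_at x (s (Row g) ?u + ?v) = of_bool (E ?u ?v)"
        using rd lt F tn by (simp add: reads_graph_def)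
      note ms = run_merge_twins[where s = ?f and g = g and x = x and N = N, OF uv(3), unfolded fs n(1)]
      have "alive g ?m = ?L - {?v}"
        using m ms(6) fs tn I n by (auto simp: alive_def)
      moreover have "?F ?m"
        using m fs by simp
      moreover have "has_cotree g ?m E (Suc j)
          (S(n + j := S (t (Node g) ?u) \<union> S (t (Node g) ?v)))"
      proof -
        have "cotree n E S (t (LChild g)) (t (RChild g)) (t (Join g)) (t (Leaves g)) j"
          using S(1) I n unfolding j has_cotree_def by simp
        note cotree_merge[OF this S(2)[unfolded j] uv]
        moreover have "?m (Order g) 0 = n"
          using m fs by simp
        ultimately show ?thesis
          unfolding has_cotree_def ms adj by simp
      qed
      moreover have "twin_classes n E (?L - {?v})
          (S(n + j := S (t (Node g) ?u) \<union> S (t (Node g) ?v))) (?m (Node g)) (Suc j)"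
        using twin_classes_merge[OF S(2)[unfolded j] tw E(2)] ms(5) by simp
      ultimately have "?I (Suc j) ?m"
        unfolding j by metis
      then show ?thesis
        using True tn by (simp add: upd_def)
    qed
  qed
  then obtain S where S: "has_cotree g (run x N (decompose g) s) E (min N (n - 1)) S"
    "twin_classes n E (alive g (run x N (decompose g) s)) S
       (run x N (decompose g) s (Node g)) (min N (n - 1))"
    by blast
  moreover have "min N (n - 1) = n - 1"
    using N by simp
  ultimately show ?thesis
    using twin_classes_final[OF _ n(2)] by metis
qed

lemma written_prepare:
  "written (prepare g) = {Acc, IdxU, IdxV, IdxW, Step, Good, TwinU, TwinV,
     Row g, Dead g, Node g, Leaves g, Join g, LChild g, RChild g}"
  by (auto simp: prepare_def multiples_def leaves_def decompose_def written_find_twins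
      written_merge_twins)

lemma run_prepare:
  assumes N: "n \<le> N" and n: "s (Order g) 0 = n" "0 < n"
    and E: "\<And>i j. i < n \<Longrightarrow> j < n \<Longrightarrow> input_at x (s (Base g) 0 + i * n + j) = of_bool (E i j)"
      "symp E" "P4_free_on {..<n} E"
    and dead: "\<And>i. s (Dead g) i = 0"
  shows "\<exists>S. has_cotree g (run x N (prepare g) s) E (n - 1) S \<and> S (2 * n - 2) = {..<n}"
proof -
  let ?r = "run x N (multiples (Row g) (scalar (Base g)) (scalar (Order g))) s"
  let ?l = "run x N (leaves g) ?r"
  have r: "?r y = s y" if "y \<notin> {Row g, Acc, IdxU}" for y
    using that by (intro run_not_written) (simp add: multiples_def)
  have l: "?l y = ?r y" if "y \<notin> {Node g, Leaves g, IdxU}" for y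
    using that by (intro run_not_written) (simp add: leaves_def)
  have row: "?r (Row g) i = s (Base g) 0 + i * n" if "i < N" for i
    using run_multiples[of "Row g" i N s x "scalar (Order g)" n "scalar (Base g)"] that n
    by simp
  have "reads_graph x g ?l E"
    using E(1) n N by (simp add: reads_graph_def l r row)
  then show ?thesis
    using run_decompose[of n N ?l g x E] N n E(2,3) dead run_leaves[of _ N x g ?r]
    by (simp add: prepare_def l r)
qed

section \<open>Verification of the table\<close>

lemma run_fill_entry:
  fixes s :: "var store"
  defines "a \<equiv> s IdxU 0" and "b \<equiv> s IdxV 0" and "T \<equiv> \<lambda>a b. s Table (s TRow a + b)"
  shows "run x N fill_entry s = upd s Table (s TRow a + b)
    (if a < s (Order First) 0 then s (Leaves Second) b
     else if b < s (Order Second) 0 then s (Leaves First) a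
     else if s (Join First) a = 0 then T (s (LChild First) a) b + T (s (RChild First) a) b
     else if s (Join Second) b = 0 then T a (s (LChild Second) b) + T a (s (RChild Second) b)
     else max (max (T (s (LChild First) a) b) (T (s (RChild First) a) b))
              (max (T a (s (LChild Second) b)) (T a (s (RChild Second) b))))"
  unfolding a_def b_def T_def fill_entry_def by (simp add: Let_def)

lemma row_major_eq_iff:
  fixes a b a' b' N :: nat
  assumes "b < N" "b' < N"
  shows "a * N + b = a' * N + b' \<longleftrightarrow> a = a' \<and> b = b'"
proof
  assume eq: "a * N + b = a' * N + b'"
  have "(a * N + b) div N = a" "(a * N + b) mod N = b" "(a' * N + b') div N = a'"
    "(a' * N + b') mod N = b'"
    using assms by simp_all
  then show "a = a' \<and> b = b'"
    using eq by metis
qed simp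

lemma run_fill_table:
  assumes A: "has_cotree First s E k S" and B: "has_cotree Second s F k' R"
    and sym: "symp E" "symp F" and irr: "\<And>v. \<not> E v v" "\<And>v. \<not> F v v"
    and row: "\<And>i. i < N \<Longrightarrow> s TRow i = i * N"
    and le: "s (Order First) 0 + k \<le> N" "s (Order Second) 0 + k' \<le> N"
    and ab: "a < s (Order First) 0 + k" "b < s (Order Second) 0 + k'"
  shows "run x N fill_table s Table (a * N + b) = prod_alpha E F (S a) (R b)"
proof -
  let ?n = "s (Order First) 0 + k" and ?m = "s (Order Second) 0 + k'"
  let ?F = "\<lambda>t. \<forall>y. y \<notin> {IdxU, IdxV, Table} \<longrightarrow> t y = s y"
  let ?ok = "\<lambda>t a b. t Table (a * N + b) = prod_alpha E F (S a) (R b)"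
  let ?I = "\<lambda>j t. ?F t \<and> (\<forall>a<?n. \<forall>b<?m. a < j \<longrightarrow> ?ok t a b)"
  let ?J = "\<lambda>j i t. ?F t \<and> t IdxU 0 = j \<and> (\<forall>a<?n. \<forall>b<?m. a < j \<or> a = j \<and> b < i \<longrightarrow> ?ok t a b)"
  have "?I N (run x N fill_table s)"
    unfolding fill_table_def
  proof (rule run_For_invariant[where I = ?I])
    fix j t assume j: "j < N" and I: "?I j t"
    have "?J j N (run x N (For IdxV fill_entry) (upd t IdxU 0 j))"
    proof (rule run_For_invariant[where I = "?J j"])
      show "?J j 0 (upd t IdxU 0 j)"
        using I by (simp add: upd_def)
    next
      fix i t assume i: "i < N" and J: "?J j i t"
      define t1 where "t1 = upd t IdxV 0 i"
      let ?t' = "run x N fill_entry t1"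
      have F: "?F t1" and idx: "t1 IdxU 0 = j" "t1 IdxV 0 = i"
        using J by (simp_all add: t1_def upd_def)
      have filled: "?ok t1 a b" if "a < ?n" "b < ?m" "a < j \<or> a = j \<and> b < i" for a b
        using J that by (simp only: t1_def upd_def fun_upd_apply var.distinct if_False)
      have trow: "t1 TRow c = c * N" if "c < N" for c
        using F row that by simp
      obtain w where t': "?t' = upd t1 Table (j * N + i) w"
        using run_fill_entry[of x N t1] idx trow[OF j] by auto
      have "?ok ?t' a b" if ab: "a < ?n" "b < ?m" "a < j \<or> a = j \<and> b < Suc i" for a b
      proof (cases "a = j \<and> b = i")
        case False
        \<comment> \<open>Columns stay below the stride \<open>N\<close>, so different pairs own
          different cells and the new entry, even a junk one, overwrites no earlier value.\<close>
        have "b < N"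
          using ab(2) le(2) by simp
        then have "a * N + b \<noteq> j * N + i"
          using row_major_eq_iff[of b N i a j] i False by simp
        then show ?thesis
          using filled[of a b] ab False unfolding t' by (auto simp: upd_def)
      next
        case True
        then have [simp]: "a = j" "b = i"
          by simp_all
        have node: "s (LChild First) j < j" "s (RChild First) j < j" if "s (Order First) 0 \<le> j"
          using A ab(1) that by (simp_all add: has_cotree_def cotree_def)
        have node': "s (LChild Second) i < i" "s (RChild Second) i < i" if "s (Order Second) 0 \<le> i"
          using B ab(2) that by (simp_all add: has_cotree_def cotree_def)
        \<comment> \<open>The operands precede the pair in the sweep: \<open>T\<close> reads an
          earlier row, \<open>T'\<close> an earlier column of the same row.\<close>
        have T: "t1 Table (t1 TRow c + i) = prod_alpha E F (S c) (R i)" if "c < j" for c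
          using filled[of c i] trow[of c] that ab(1,2) j by simp
        have T': "t1 Table (t1 TRow j + c) = prod_alpha E F (S j) (R c)" if "c < i" for c
          using filled[of j c] trow[OF j] that ab(1,2) by simp
        have fr: "t1 (Order g) = s (Order g)" "t1 (Leaves g) = s (Leaves g)"
          "t1 (Join g) = s (Join g)" "t1 (LChild g) = s (LChild g)" "t1 (RChild g) = s (RChild g)" for g
          using F by simp_all
        have "?t' Table (j * N + i) = prod_alpha E F (S j) (R i)"
          unfolding run_fill_entry idx
          unfolding prod_alpha_cotree[OF A[unfolded has_cotree_def] B[unfolded has_cotree_def]
              sym irr ab(1,2), unfolded \<open>a = j\<close> \<open>b = i\<close>]
          using trow[OF j] T[OF node(1)] T[OF node(2)] T'[OF node'(1)] T'[OF node'(2)]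
          by (simp add: fr upd_def)
        then show ?thesis
          by simp
      qed
      moreover have "?F ?t'" "?t' IdxU 0 = j"
        using F idx unfolding t' by (simp_all add: upd_def)
      ultimately show "?J j (Suc i) (run x N fill_entry (upd t IdxV 0 i))"
        unfolding t1_def by blast
    qed
    then show "?I (Suc j) (run x N (For IdxV fill_entry) (upd t IdxU 0 j))"
      using le(2) by (meson less_SucE order_less_le_trans)
  qed auto
  then show ?thesis
    using ab le(1) by (meson order_less_le_trans)
qed

section \<open>The two phases together\<close>

lemma run_phase1:
  "run x N phase1 (\<lambda>_ _. 0) Acc 0 = N * input_at x 0"
proof -
  have "(\<lambda>j t. t Acc 0 = j * input_at x 0) N (run x N phase1 (\<lambda>_ _. 0))"
    unfolding phase1_def by (rule run_For_invariant) (simp_all add: upd_def)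
  then show ?thesis .
qed

text \<open>The first phase leaves only \<open>Acc\<close> and a loop counter behind, so
  \<open>Dead\<close> and \<open>Result\<close> still start at 0.\<close>

lemma run_phase2:
  fixes s :: "var store" and n m :: nat
  defines "N \<equiv> 2 * n + 2 * m"
  assumes s: "s Acc 0 = n * n" "\<And>v. v \<notin> {Acc, IdxU} \<Longrightarrow> s v = (\<lambda>_. 0)"
    and x: "input_at x 0 = n" "input_at x (1 + n * n) = m"
    and E: "\<And>i j. i < n \<Longrightarrow> j < n \<Longrightarrow> input_at x (1 + i * n + j) = of_bool (E i j)"
      "symp E" "\<And>v. \<not> E v v" "P4_free_on {..<n} E"
    and F: "\<And>i j. i < m \<Longrightarrow> j < m \<Longrightarrow> input_at x (2 + n * n + i * m + j) = of_bool (F i j)"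
      "symp F" "\<And>v. \<not> F v v" "P4_free_on {..<m} F"
  shows "run x N phase2 s Result 0 = prod_alpha E F {..<n} {..<m}"
proof -
  let ?h = "run x N header s"
  let ?p = "run x N (prepare First) ?h"
  let ?q = "run x N (prepare Second) ?p"
  let ?r = "run x N (multiples TRow (Num 0) (width (scalar (Order First)) (scalar (Order Second)))) ?q"
  let ?f = "run x N fill_table ?r"
  have phase2: "run x N phase2 s = run x N report ?f"
    by (simp add: phase2_def)
  have h: "?h (Order First) 0 = n" "?h (Order Second) 0 = m" "?h (Base First) 0 = 1"
    "?h (Base Second) 0 = 2 + n * n" "?h (Dead g) i = 0" "?h Result 0 = 0" for g i
    using s x by (simp_all add: header_def upd_def)
  have p: "?p y = ?h y" if "y \<in> {Order g, Base Second, Dead Second, Result}" for y g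
    using that by (intro run_not_written) (auto simp: written_prepare)
  have q: "?q y = ?p y"
    if "y \<in> {Order g, Leaves First, Join First, LChild First, RChild First, Result}" for y g
    using that by (intro run_not_written) (auto simp: written_prepare)
  have r: "?r y = ?q y" if "y \<notin> {TRow, Acc, IdxU}" for y
    using that by (intro run_not_written) (simp add: multiples_def)
  have f: "?f y = ?r y" if "y \<notin> {IdxU, IdxV, Table}" for y
    using that by (intro run_not_written) (auto simp: fill_table_def fill_entry_def Let_def)
  have ord: "?r (Order First) 0 = n" "?r (Order Second) 0 = m"
    "?f (Order First) 0 = n" "?f (Order Second) 0 = m" "?q (Order First) 0 = n"
    "?q (Order Second) 0 = m" and res: "?f Result 0 = 0"
    using f r q p h by simp_all
  show ?thesis
  proof (cases "0 < n \<and> 0 < m")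
    case False
    then have "run x N report ?f Result 0 = 0"
      using ord res by (auto simp: report_def)
    moreover have "prod_alpha E F {..<n} {..<m} = 0"
      using False by (intro prod_alpha_empty) auto
    ultimately show ?thesis
      unfolding phase2 by simp
  next
    case True
    have NN: "n \<le> N" "m \<le> N" "n + (n - 1) \<le> N" "m + (m - 1) \<le> N"
      by (simp_all add: N_def)
    obtain S where S: "has_cotree First ?p E (n - 1) S" "S (2 * n - 2) = {..<n}"
      using run_prepare[of n N ?h First x E] NN True h E by auto
    obtain R where R: "has_cotree Second ?q F (m - 1) R" "R (2 * m - 2) = {..<m}"
      using run_prepare[of m N ?p Second x F] NN True h p F by auto
    have SR: "has_cotree First ?r E (n - 1) S" "has_cotree Second ?r F (m - 1) R"
      using S(1) R(1) r q by (simp_all add: has_cotree_def)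
    have trow: "?r TRow i = i * N" if "i < N" for i
      using run_multiples[of TRow i N ?q x "width (scalar (Order First)) (scalar (Order Second))" N "Num 0"]
        that ord by (simp add: width_def N_def)
    have idx: "2 * n - 2 < n + (n - 1)" "2 * m - 2 < m + (m - 1)" "2 * n - 2 < N"
      using True by (auto simp: N_def)
    have "?f Table ((2 * n - 2) * N + (2 * m - 2)) = prod_alpha E F (S (2 * n - 2)) (R (2 * m - 2))"
      by (rule run_fill_table[OF SR E(2) F(2) E(3) F(3) trow, unfolded ord, OF _ NN(3,4) idx(1,2)])
    then have "run x N report ?f Result 0 = prod_alpha E F {..<n} {..<m}"
      using True ord f trow[OF idx(3)] S(2) R(2) by (simp add: report_def upd_def mult_2)
    then show ?thesis
      unfolding phase2 .
  qed
qed

section \<open>The encoding\<close>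

lemma length_concat_rows: "length (concat (map (\<lambda>i. map (f i) [0..<n]) [0..<m])) = m * n"
  by (induction m) simp_all

lemma nth_concat_rows:
  assumes "i < m" "j < n"
  shows "concat (map (\<lambda>i. map (f i) [0..<n]) [0..<m]) ! (i * n + j) = f i j"
  using assms(1)
proof (induction m)
  case (Suc m)
  let ?c = "concat (map (\<lambda>i. map (f i) [0..<n]) [0..<m])"
  have len: "length ?c = m * n"
    by (rule length_concat_rows)
  have split: "concat (map (\<lambda>i. map (f i) [0..<n]) [0..<Suc m]) = ?c @ map (f m) [0..<n]"
    by simp
  show ?case
  proof (cases "i < m")
    case True
    have "i * n + j < Suc i * n"
      using assms(2) by simp
    also have "\<dots> \<le> m * n"
      using True by (intro mult_le_mono1) simp
    finally show ?thesis
      using Suc.IH[OF True] unfolding split by (simp add: nth_append len)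
  next
    case False
    then have "i = m"
      using Suc.prems by simp
    then show ?thesis
      using assms(2) unfolding split by (simp add: nth_append len)
  qed
qed simp

lemma encode_graph_eq:
  "encode_graph G = card (verts G) # concat (map (\<lambda>i. map (\<lambda>j. of_bool ({i, j} \<in> edges G))
     [0..<card (verts G)]) [0..<card (verts G)])"
  by (simp add: encode_graph_def Let_def)

lemma length_encode_graph: "length (encode_graph G) = 1 + card (verts G) * card (verts G)"
  unfolding encode_graph_eq by (simp only: length_Cons length_concat_rows)

lemma nth_encode_graph:
  assumes "i < card (verts G)" "j < card (verts G)"
  shows "encode_graph G ! (1 + i * card (verts G) + j) = of_bool ({i, j} \<in> edges G)"
  unfolding encode_graph_eq
  using nth_concat_rows[OF assms, of "\<lambda>i j. of_bool ({i, j} \<in> edges G)"] by simp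

lemma row_major_less:
  fixes i j n :: nat
  assumes "i < n" "j < n"
  shows "i * n + j < n * n"
proof -
  have "i * n + j < Suc i * n"
    using assms(2) by simp
  also have "\<dots> \<le> n * n"
    using assms(1) by (intro mult_le_mono1) simp
  finally show ?thesis .
qed

lemma input_at_encode_graph_pair:
  fixes G H :: "nat graph"
  defines "n \<equiv> card (verts G)" and "m \<equiv> card (verts H)"
    and "x \<equiv> encode_graph_pair (G, H)"
  shows "input_at x 0 = n" "input_at x (1 + n * n) = m"
    "i < n \<Longrightarrow> j < n \<Longrightarrow> input_at x (1 + i * n + j) = of_bool ({i, j} \<in> edges G)"
    "i < m \<Longrightarrow> j < m \<Longrightarrow> input_at x (2 + n * n + i * m + j) = of_bool ({i, j} \<in> edges H)"
    "length x = 2 + n * n + m * m"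
proof -
  have x: "x = encode_graph G @ encode_graph H"
    by (simp add: x_def encode_graph_pair_def)
  have len: "length (encode_graph G) = 1 + n * n" "length (encode_graph H) = 1 + m * m"
    by (simp_all add: length_encode_graph n_def m_def)
  show "length x = 2 + n * n + m * m"
    by (simp add: x len)
  have "encode_graph G ! 0 = n" "encode_graph H ! 0 = m"
    by (simp_all add: encode_graph_eq n_def m_def)
  then show "input_at x 0 = n" "input_at x (1 + n * n) = m"
    by (simp_all add: input_at_def x len nth_append)
  show "input_at x (1 + i * n + j) = of_bool ({i, j} \<in> edges G)" if "i < n" "j < n"
    using row_major_less[OF that] nth_encode_graph[of i G j] that
    by (simp add: input_at_def x len nth_append flip: n_def)
  show "input_at x (2 + n * n + i * m + j) = of_bool ({i, j} \<in> edges H)" if "i < m" "j < m"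
    using row_major_less[OF that] nth_encode_graph[of i H j] that
    by (simp add: input_at_def x len nth_append flip: m_def)
qed

lemma length_le_bit_size: "length x \<le> bit_size x"
  by (induction x) (simp_all add: bit_size_def)

lemma cograph_adjacency:
  assumes "cograph G"
  defines "E \<equiv> \<lambda>u v. {u, v} \<in> edges G"
  shows "symp E" "\<And>v. \<not> E v v" "P4_free_on (verts G) E"
proof -
  have edge: "e \<subseteq> verts G \<and> card e = 2" if "e \<in> edges G" for e
    using assms(1) that by (simp add: cograph_def finite_simple_graph_def)
  show "symp E"
    by (simp add: E_def symp_def insert_commute)
  \<comment> \<open>A loop would be the edge \<open>{v, v}\<close>, a singleton.\<close>
  show "\<not> E v v" for v
    using edge[of "{v}"] by (auto simp: E_def)
  show "P4_free_on (verts G) E"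
    unfolding P4_free_on_def
  proof (intro ballI impI notI)
    fix a b c d
    assume "a \<in> verts G" "b \<in> verts G" "c \<in> verts G" "d \<in> verts G" "distinct [a, b, c, d]"
      "E a b \<and> E b c \<and> E c d \<and> \<not> E a c \<and> \<not> E a d \<and> \<not> E b d"
    then have "induced_P4 G a b c d"
      by (simp add: induced_P4_def E_def)
    then show False
      using assms(1) by (auto simp: cograph_def)
  qed
qed

section \<open>Numbering of the program variables\<close>

definition all_vars :: "var list" where
  "all_vars =
     concat (map (\<lambda>g. [Order g, Base g, Row g, Dead g, Node g, Leaves g, Join g, LChild g, RChild g])
       [First, Second]) @
     [TRow, Table, IdxU, IdxV, IdxW, Step, Good, TwinU, TwinV, Acc, Result]"

definition var_num :: "var \<Rightarrow> nat" where
  "var_num v = length (takeWhile (\<lambda>w. w \<noteq> v) all_vars)"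

lemma var_num_less: "var_num v < length all_vars"
proof -
  have "g = First \<or> g = Second" for g
    by (cases g) simp_all
  then have "v \<in> set all_vars"
    by (cases v) (simp_all add: all_vars_def)
  then have "dropWhile (\<lambda>w. w \<noteq> v) all_vars \<noteq> []"
    by simp
  then show ?thesis
    unfolding var_num_def
    by (metis takeWhile_dropWhile_id length_append length_greater_0_conv less_add_same_cancel1)
qed

lemma nth_var_num: "all_vars ! var_num v = v"
  using nth_length_takeWhile[of "\<lambda>w. w \<noteq> v" all_vars] var_num_less[of v]
  by (simp add: var_num_def)

text \<open>The exponent 5 gives 32 residues for the 29 variables, and 32 registers, enough for the
  nesting depth of the program.\<close>

global_interpretation ram: layout var_num 5
proof
  show "inj var_num"
    by (metis injI nth_var_num)
  show "var_num v < 2 ^ 5" for v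
    using var_num_less[of v] by (simp add: all_vars_def)
qed

theorem theorem1:
  "poly_time_computable_on
     {(G, H). cograph G \<and> numbered G \<and> cograph H \<and> numbered H}
     encode_graph_pair
     (\<lambda>(G, H). independence_number (tensor_product G H))"
proof -
  let ?n = "Input (Num 0) :: var expr"
  \<comment> \<open>After the first phase \<open>Acc\<close> is the square of \<open>n\<close>, so
    the entry read is the order of the second graph.\<close>
  let ?w = "width ?n (Input (Plus (Num 1) (scalar Acc)))"
  let ?P = "ram.two_phase_code ?n phase1 ?w phase2 (scalar Result)"
  let ?p = "ram.two_phase_time ?n phase1 ?w phase2 (scalar Result)"
  have depth: "1 + expr_depth ?n \<le> 2 ^ 5" "2 + com_depth phase1 \<le> 2 ^ 5"
    "1 + expr_depth ?w \<le> 2 ^ 5" "2 + com_depth phase2 \<le> 2 ^ 5" "expr_depth (scalar Result) \<le> 2 ^ 5"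
    by (simp_all add: phase1_def phase2_def width_def header_def prepare_def multiples_def leaves_def
        decompose_def find_twins_def merge_twins_def try_pair_def test_twins_def candidates_def
        separates_def fill_table_def fill_entry_def report_def table_def adjacent_def Less_def
        Differ_def Both_def Neg_def Maximum_def Let_def)
  \<comment> \<open>Both loop bounds are at most twice the bit size; composing with
    \<open>[:0, 2:]\<close> substitutes this into the time bound.\<close>
  have main: "halts_within ?P (encode_graph_pair (G, H))
      (poly (pcompose ?p [:0, 2:]) (bit_size (encode_graph_pair (G, H))))
      (independence_number (tensor_product G H))"
    if G: "cograph G" "numbered G" and H: "cograph H" "numbered H" for G H
  proof -
    define n m x where "n = card (verts G)" and "m = card (verts H)"
      and "x = encode_graph_pair (G, H)"
    let ?E = "\<lambda>u v. {u, v} \<in> edges G" and ?F = "\<lambda>u v. {u, v} \<in> edges H"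
    note input = input_at_encode_graph_pair[where G = G and H = H, folded n_def m_def x_def]
    have V: "verts G = {..<n}" "verts H = {..<m}"
      using G(2) H(2) unfolding numbered_def n_def m_def by blast+
    let ?s = "run x n phase1 (\<lambda>_ _. 0)"
    have s: "?s Acc 0 = n * n" "\<And>v. v \<notin> {Acc, IdxU} \<Longrightarrow> ?s v = (\<lambda>_. 0)"
      using run_phase1[of x n] input(1) by (simp, intro run_not_written) (simp add: phase1_def)
    have e: "eval x (\<lambda>_ _. 0) ?n = n" "eval x ?s ?w = 2 * n + 2 * m"
      using input(1,2) s(1) by (simp_all add: width_def)
    \<comment> \<open>The input has \<open>2 + n * n + m * m\<close> entries, hence
      \<open>n + m\<close> is at most its length.\<close>
    have "n \<le> n * n" "m \<le> m * m"
      by simp_all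
    then have "n \<le> 2 * bit_size x" "2 * n + 2 * m \<le> 2 * bit_size x"
      using length_le_bit_size[of x] input(5) by linarith+
    then have "halts_within ?P x (poly ?p (2 * bit_size x))
        (run x (2 * n + 2 * m) phase2 ?s Result 0)"
      using ram.two_phase_code_correct[OF refl refl refl _ _ depth, of x "2 * bit_size x"] e by simp
    moreover have "run x (2 * n + 2 * m) phase2 ?s Result 0 = prod_alpha ?E ?F {..<n} {..<m}"
      using cograph_adjacency[OF G(1), unfolded V] cograph_adjacency[OF H(1), unfolded V] s input(1-4)
      by (intro run_phase2)
    moreover have "\<dots> = independence_number (tensor_product G H)"
      using independence_number_tensor_product[of G H] V by simp
    ultimately show ?thesis
      by (simp add: poly_pcompose mult.commute flip: x_def)
  qed
  show ?thesis
    unfolding poly_time_computable_on_def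
  proof (intro exI ballI)
    fix i :: "nat graph \<times> nat graph"
    assume "i \<in> {(G, H). cograph G \<and> numbered G \<and> cograph H \<and> numbered H}"
    then obtain G H where i: "i = (G, H)" "cograph G" "numbered G" "cograph H" "numbered H"
      by blast
    show "halts_within ?P (encode_graph_pair i)
        (poly (pcompose ?p [:0, 2:]) (bit_size (encode_graph_pair i)))
        (case i of (G, H) \<Rightarrow> independence_number (tensor_product G H))"
      unfolding i(1) prod.case by (rule main[OF i(2-5)])
  qed
qed

end
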